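(* Let $\mathcal{X}$ be a Polish space and let $H_0$ versus $H_1$ be a hypothesis testing problem over $\mathcal{X}$ whose ambient space $H_0\cup H_1$ (with the subspace topology inherited from the weak topology) is a Baire space. Then the following conditions are equivalent: (1) The two hypotheses $H_0$ and $H_1$ are nowhere intertwined. (2) There exists a finite-precision test that achieves almost everywhere consistency in each hypothesis. (3) There exists a finite-precision test that achieves both (i) dense consistency in each hypothesis and (ii) almost everywhere consistency. (4) There exists a finite-precision test that achieves both (i) dense consistency in each hypothesis and (ii) comeager consistency.
   Context: $\mathcal{X}$ is a Polish space with Borel $\sigma$-algebra $\mathscr{B}(\mathcal{X})$. The set of all probability measures on $\mathscr{B}(\mathcal{X})$ carries the weak topology (the topology of weak convergence of measures), and every subset of it carries the subspace topology. A hypothesis is a set of probability measures on $\mathscr{B}(\mathcal{X})$; a hypothesis testing problem consists of two disjoint hypotheses $H_0$ and $H_1$. The ambient topological space is $H_0\cup H_1$ with the subspace topology. A test $\varphi$ is a sequence of measurable functions $\varphi_n:\mathcal{X}^n\to\{0,1,\texttt{?}\}$, $n=1,2,\ldots$; write $\{\varphi_n=i\}=\{x\in\mathcal{X}^n:\varphi_n(x)=i\}$. The test $\varphi$ is finite-precision iff for every $n$ and every $i\in\{0,1\}$ the set $\{\varphi_n=i\}$ is open in $\mathcal{X}^n$ (product topology). For $\mathbb{P}\in H_i$, $\varphi$ is consistent at $\mathbb{P}$ iff $\mathbb{P}^n\{\varphi_n=i\}\to 1$ as $n\to\infty$, where $\mathbb{P}^n$ is the $n$-fold product measure of $\mathbb{P}$;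 $\varphi$ is consistent on a set $S$ iff it is consistent at every element of $S$. Nowhere dense, meager and comeager (= complement meager) have their standard meanings. A Baire space is a space in which every comeager set is dense (equivalently, no nonempty open set is meager). The standards are: - Dense consistency in each hypothesis: for each $i\in\{0,1\}$, $\varphi$ is consistent on some dense subset of $H_i$. - Almost everywhere consistency in each hypothesis: for each $i\in\{0,1\}$, the set of measures in $H_i$ at which $\varphi$ is consistent equals $H_i$ minus a subset that is nowhere dense in $H_i$ (with respect to the subspace topology of $H_i$ itself). - Almost everywhere consistency: the set of measures in $H_0\cup H_1$ at which $\varphi$ is consistent equals $H_0\cup H_1$ minus a subset that is nowhere dense in $H_0\cup H_1$. - Comeager consistency: the set of measures in $H_0\cup H_1$ at which $\varphi$ is consistent is comeager in $H_0\cup H_1$. $H_0$ and $H_1$ are intertwined in a nonempty open subset $O$ of $H_0\cup H_1$ iff both $H_0$ and $H_1$ are dense in $O$ (i.e. $H_0\cap O$ and $H_1\cap O$ are both dense in $O$). They are nowhere intertwined iff they are intertwined in no nonempty open subset of $H_0\cup H_1$. *)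

theory Defs
  imports "HOL-Probability.Probability"
begin

definition dense_in :: "'a topology \<Rightarrow> 'a set \<Rightarrow> bool" where
  "dense_in T S \<longleftrightarrow> S \<subseteq> topspace T \<and> T closure_of S = topspace T"

definition nowhere_dense_in :: "'a topology \<Rightarrow> 'a set \<Rightarrow> bool" where
  "nowhere_dense_in T S \<longleftrightarrow> S \<subseteq> topspace T \<and> T interior_of (T closure_of S) = {}"

definition meager_in :: "'a topology \<Rightarrow> 'a set \<Rightarrow> bool" where
  "meager_in T S \<longleftrightarrow>
     (\<exists>\<N>. countable \<N> \<and> (\<forall>N\<in>\<N>. nowhere_dense_in T N) \<and> S = \<Union>\<N>)"

definition comeager_in :: "'a topology \<Rightarrow> 'a set \<Rightarrow> bool" where
  "comeager_in T S \<longleftrightarrow> S \<subseteq> topspace T \<and> meager_in T (topspace T - S)"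

definition Baire_topology :: "'a topology \<Rightarrow> bool" where
  "Baire_topology T \<longleftrightarrow> (\<forall>S. comeager_in T S \<longrightarrow> dense_in T S)"

definition borel_prob_measures :: "'a::topological_space measure set" where
  "borel_prob_measures = {P. prob_space P \<and> sets P = sets borel}"

text \<open>
  The coarsest topology on the Borel probability measures for which integration of every bounded
  continuous real function is continuous. The choice \<open>U = UNIV\<close> makes the topspace equal to
  \<^const>\<open>borel_prob_measures\<close>.
\<close>
definition weak_topology :: "'a::topological_space measure topology" where
  "weak_topology = topology_generated_by
     {{P \<in> borel_prob_measures. (\<integral>x. f x \<partial>P) \<in> U} | (f :: 'a \<Rightarrow> real) U.
        continuous_on UNIV f \<and> bounded (range f) \<and> open U}"

lemma topspace_weak_topology [simp]: "topspace weak_topology = borel_prob_measures"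
proof -
  have "borel_prob_measures \<in>
     {{P \<in> borel_prob_measures. (\<integral>x. f x \<partial>P) \<in> U} | (f :: 'a \<Rightarrow> real) U.
        continuous_on UNIV f \<and> bounded (range f) \<and> open U}"
    by (rule CollectI, rule exI[of _ "\<lambda>_. 0"], rule exI[of _ UNIV]) simp
  then show ?thesis
    unfolding weak_topology_def topology_generated_by_topspace by blast
qed

lemma limitin_weak_topology:
  fixes P :: "'a::topological_space measure"
  shows "limitin weak_topology Q P F \<longleftrightarrow>
     P \<in> borel_prob_measures \<and> (\<forall>\<^sub>F n in F. Q n \<in> borel_prob_measures) \<and>
     (\<forall>f::'a \<Rightarrow> real. continuous_on UNIV f \<and> bounded (range f) \<longrightarrow>
        ((\<lambda>n. \<integral>x. f x \<partial>Q n) \<longlongrightarrow> (\<integral>x. f x \<partial>P)) F)"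
    (is "?lhs \<longleftrightarrow> ?rhs")
proof
  assume L: ?lhs
  have "((\<lambda>n. \<integral>x. f x \<partial>Q n) \<longlongrightarrow> (\<integral>x. f x \<partial>P)) F"
    if "continuous_on UNIV f" "bounded (range f)" for f :: "'a \<Rightarrow> real"
  proof (rule topological_tendstoI)
    fix U :: "real set" assume U: "open U" "(\<integral>x. f x \<partial>P) \<in> U"
    have "openin weak_topology {P \<in> borel_prob_measures. (\<integral>x. f x \<partial>P) \<in> U}"
      unfolding weak_topology_def by (rule topology_generated_by_Basis) (use that U in blast)
    with L U have "\<forall>\<^sub>F n in F. Q n \<in> {P \<in> borel_prob_measures. (\<integral>x. f x \<partial>P) \<in> U}"
      using limitin_topspace[OF L] by (intro limitinD[OF L]) auto
    then show "\<forall>\<^sub>F n in F. (\<integral>x. f x \<partial>Q n) \<in> U"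
      by (rule eventually_mono) auto
  qed
  moreover have "\<forall>\<^sub>F n in F. Q n \<in> borel_prob_measures"
    using limitinD[OF L openin_topspace] limitin_topspace[OF L] by simp
  ultimately show ?rhs
    using limitin_topspace[OF L] by simp
next
  assume R: ?rhs
  have "\<forall>\<^sub>F n in F. Q n \<in> W"
    if "generate_topology_on {{P \<in> borel_prob_measures. (\<integral>x. f x \<partial>P) \<in> U} | (f :: 'a \<Rightarrow> real) U.
        continuous_on UNIV f \<and> bounded (range f) \<and> open U} W" "P \<in> W" for W
    using that
  proof (induction W)
    case Empty then show ?case by simp
  next
    case (Int a b) then show ?case by (simp add: eventually_conj_iff)
  next
    case (UN K)
    then obtain k where k: "k \<in> K" "P \<in> k" by blast
    have "\<forall>\<^sub>F n in F. Q n \<in> k" by (rule UN.IH[OF k])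
    then show ?case by (rule eventually_mono) (use k in blast)
  next
    case (Basis s)
    then obtain f :: "'a \<Rightarrow> real" and U where
      s: "s = {P \<in> borel_prob_measures. (\<integral>x. f x \<partial>P) \<in> U}" and
      f: "continuous_on UNIV f" "bounded (range f)" and U: "open U"
      by blast
    have t: "((\<lambda>n. \<integral>x. f x \<partial>Q n) \<longlongrightarrow> (\<integral>x. f x \<partial>P)) F" using R f by blast
    have "\<forall>\<^sub>F n in F. (\<integral>x. f x \<partial>Q n) \<in> U"
      by (rule topological_tendstoD[OF t U]) (use Basis s in simp)
    moreover have "\<forall>\<^sub>F n in F. Q n \<in> borel_prob_measures" using R by blast
    ultimately show ?case
      by eventually_elim (simp add: s)
  qed
  then show ?lhs
    using R by (simp add: limitin_def) (simp add: weak_topology_def openin_topology_generated_by_iff)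
qed

text \<open>\<open>Accept0\<close>, \<open>Accept1\<close> and \<open>Undecided\<close> are the outputs 0, 1 and ?.\<close>
datatype verdict = Accept0 | Accept1 | Undecided

text \<open>
  Samples of size \<open>n\<close> are the extensional functions in \<open>{..<n} \<rightarrow>\<^sub>E UNIV\<close>, which is the common
  carrier of the product \<open>\<sigma>\<close>-algebra and the product topology. The value of a test at \<open>n = 0\<close> is
  irrelevant: all conditions are imposed for \<open>n \<ge> 1\<close> or are asymptotic.
\<close>
type_synonym 'a test = "nat \<Rightarrow> (nat \<Rightarrow> 'a) \<Rightarrow> verdict"

definition is_test :: "'a::topological_space test \<Rightarrow> bool" where
  "is_test \<phi> \<longleftrightarrow>
     (\<forall>n\<ge>1. \<phi> n \<in> measurable (\<Pi>\<^sub>M i\<in>{..<n}. borel) (count_space UNIV))"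

definition verdict_region :: "'a test \<Rightarrow> nat \<Rightarrow> verdict \<Rightarrow> (nat \<Rightarrow> 'a) set" where
  "verdict_region \<phi> n v = {x \<in> {..<n} \<rightarrow>\<^sub>E UNIV. \<phi> n x = v}"

definition finite_precision :: "'a::topological_space test \<Rightarrow> bool" where
  "finite_precision \<phi> \<longleftrightarrow> (\<forall>n\<ge>1. \<forall>v\<in>{Accept0, Accept1}.
     openin (product_topology (\<lambda>_. euclidean) {..<n}) (verdict_region \<phi> n v))"

definition consistent_at :: "'a test \<Rightarrow> verdict \<Rightarrow> 'a measure \<Rightarrow> bool" where
  "consistent_at \<phi> v P \<longleftrightarrow>
     (\<lambda>n. measure (\<Pi>\<^sub>M i\<in>{..<n}. P) (verdict_region \<phi> n v)) \<longlonglongrightarrow> 1"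

definition consistency_set :: "'a test \<Rightarrow> 'a measure set \<Rightarrow> 'a measure set \<Rightarrow> 'a measure set" where
  "consistency_set \<phi> H0 H1 =
     {P \<in> H0. consistent_at \<phi> Accept0 P} \<union> {P \<in> H1. consistent_at \<phi> Accept1 P}"

definition densely_consistent_on ::
    "'a::topological_space test \<Rightarrow> verdict \<Rightarrow> 'a measure set \<Rightarrow> bool" where
  "densely_consistent_on \<phi> v H \<longleftrightarrow>
     (\<exists>D. dense_in (subtopology weak_topology H) D \<and> (\<forall>P\<in>D. consistent_at \<phi> v P))"

definition dense_consistency_each ::
    "'a::topological_space test \<Rightarrow> 'a measure set \<Rightarrow> 'a measure set \<Rightarrow> bool" where
  "dense_consistency_each \<phi> H0 H1 \<longleftrightarrow>
     densely_consistent_on \<phi> Accept0 H0 \<and> densely_consistent_on \<phi> Accept1 H1"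

definition ae_consistent_on ::
    "'a::topological_space test \<Rightarrow> verdict \<Rightarrow> 'a measure set \<Rightarrow> bool" where
  "ae_consistent_on \<phi> v H \<longleftrightarrow>
     (\<exists>N. nowhere_dense_in (subtopology weak_topology H) N \<and> {P \<in> H. consistent_at \<phi> v P} = H - N)"

definition ae_consistency_each ::
    "'a::topological_space test \<Rightarrow> 'a measure set \<Rightarrow> 'a measure set \<Rightarrow> bool" where
  "ae_consistency_each \<phi> H0 H1 \<longleftrightarrow>
     ae_consistent_on \<phi> Accept0 H0 \<and> ae_consistent_on \<phi> Accept1 H1"

definition ae_consistency ::
    "'a::topological_space test \<Rightarrow> 'a measure set \<Rightarrow> 'a measure set \<Rightarrow> bool" where
  "ae_consistency \<phi> H0 H1 \<longleftrightarrow>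
     (\<exists>N. nowhere_dense_in (subtopology weak_topology (H0 \<union> H1)) N \<and>
          consistency_set \<phi> H0 H1 = (H0 \<union> H1) - N)"

definition comeager_consistency ::
    "'a::topological_space test \<Rightarrow> 'a measure set \<Rightarrow> 'a measure set \<Rightarrow> bool" where
  "comeager_consistency \<phi> H0 H1 \<longleftrightarrow>
     comeager_in (subtopology weak_topology (H0 \<union> H1)) (consistency_set \<phi> H0 H1)"

definition intertwined_in ::
    "'a::topological_space measure set \<Rightarrow> 'a measure set \<Rightarrow> 'a measure set \<Rightarrow> bool" where
  "intertwined_in H0 H1 U \<longleftrightarrow>
     dense_in (subtopology weak_topology U) (H0 \<inter> U) \<and>
     dense_in (subtopology weak_topology U) (H1 \<inter> U)"

definition nowhere_intertwined ::
    "'a::topological_space measure set \<Rightarrow> 'a measure set \<Rightarrow> bool" where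
  "nowhere_intertwined H0 H1 \<longleftrightarrow>
     \<not> (\<exists>U. openin (subtopology weak_topology (H0 \<union> H1)) U \<and> U \<noteq> {} \<and> intertwined_in H0 H1 U)"

end

theory Submission
  imports Defs
begin

text \<open>
  Almost everywhere consistency in each hypothesis implies dense consistency together with almost
  everywhere consistency, because a nowhere dense subset of a subspace is nowhere dense in the
  ambient space, and nowhere dense sets are meager. The substance lies in the two remaining
  implications, which close the cycle.

  If the hypotheses are nowhere intertwined, then the union of the interiors \<open>U0\<close> and \<open>U1\<close> of
  \<open>H0\<close> and \<open>H1\<close> in the ambient space is open and dense. Write \<open>V0\<close> and \<open>V1\<close> for the complements of
  the closures of \<open>U0\<close> and \<open>U1\<close>. The sets \<open>U0 \<union> (V0 - U1)\<close> and \<open>U1 \<union> (V1 - U0)\<close> are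
  disjoint countable unions of closed sets, and each contains all but a nowhere dense part of its
  hypothesis. Disjoint countable unions of closed sets of measures can be told apart in the limit by a
  finite-precision test: countably many continuous functions into \<open>{0..1}\<close> generate the weak
  topology by their integrals (\<open>weak_topology_eq_pullback_moments\<close>), the corresponding empirical
  moments depend continuously on the sample, and they approach the true moments at a rate that is
  uniform in the measure (\<open>empirical_moments_concentrate\<close>). The test reports which of the closed sets is
  the first to come within a slowly shrinking distance of the empirical moments
  (\<open>finite_precision_test_of_closed_sequences\<close>).

  Conversely, the measure of an open subset of the sample space under \<open>P\<^sup>n\<close> is lower semicontinuous
  in \<open>P\<close> (\<open>openin_weak_topology_sample_measure_greater\<close>). If both hypotheses are dense in an open set
  \<open>U\<close> and a finite-precision test is consistent on dense parts of each, then on a comeager subset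
  of \<open>U\<close> either verdict has probability above \<open>2/3\<close> at arbitrarily large sample sizes. No measure in
  this set is a point of consistency, so in a Baire space the consistency set is not comeager.
\<close>

section \<open>Approximating continuous functions from below\<close>

text \<open>
  The members are the cones \<open>y \<mapsto> max 0 (s - q * dist x y)\<close> with \<open>x\<close> in a countable dense set,
  rational height \<open>s\<close> and integral slope \<open>q\<close>. The last property gives a cone that sits over a
  prescribed open set, is capped by \<open>t\<close>, and still exceeds \<open>r\<close> at a prescribed point: any
  height strictly between \<open>r\<close> and \<open>t\<close> works once the slope is large and the apex close to \<open>y\<close>.
\<close>
lemma countable_bump_family:
  obtains F :: "('a::{metric_space, second_countable_topology} \<Rightarrow> real) set" where
    "countable F"
    "\<And>\<phi>. \<phi> \<in> F \<Longrightarrow> continuous_on UNIV \<phi>"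
    "\<And>\<phi> x. \<phi> \<in> F \<Longrightarrow> 0 \<le> \<phi> x \<and> \<phi> x \<le> 1"
    "\<And>U y r t. open U \<Longrightarrow> y \<in> U \<Longrightarrow> 0 \<le> r \<Longrightarrow> r < t \<Longrightarrow> t \<le> 1 \<Longrightarrow>
       \<exists>\<phi>\<in>F. r < \<phi> y \<and> (\<forall>z. \<phi> z \<le> t) \<and> (\<forall>z. z \<notin> U \<longrightarrow> \<phi> z = 0)"
proof -
  obtain D :: "'a set" where D: "countable D"
    "\<And>X. open X \<Longrightarrow> X \<noteq> {} \<Longrightarrow> \<exists>d\<in>D. d \<in> X"
    using countable_dense_setE by blast
  define \<Phi> where "\<Phi> = (\<lambda>(x::'a, s, q) y. max 0 (s - real q * dist x y))"
  define F where "F = \<Phi> ` (D \<times> ({0..1} \<inter> \<rat>) \<times> (UNIV :: nat set))"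
  show thesis
  proof (rule that)
    show "countable F"
      unfolding F_def by (intro countable_image countable_SIGMA D countableI_type countable_Int2 countable_rat)
    show "continuous_on UNIV \<phi>" if "\<phi> \<in> F" for \<phi>
      using that by (auto simp: F_def \<Phi>_def intro!: continuous_intros)
    show "0 \<le> \<phi> x \<and> \<phi> x \<le> 1" if "\<phi> \<in> F" for \<phi> x
    proof -
      obtain d s q where "\<phi> = \<Phi> (d, s, q)" "s \<le> 1"
        using \<open>\<phi> \<in> F\<close> by (auto simp: F_def)
      moreover have "0 \<le> real q * dist d x" by simp
      ultimately show ?thesis
        unfolding \<Phi>_def by (simp only: prod.case) linarith
    qed
  next
    fix U :: "'a set" and y and r t :: real
    assume U: "open U" "y \<in> U" and rt: "0 \<le> r" "r < t" "t \<le> 1"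
    obtain s where s: "s \<in> \<rat>" "r < s" "s < t"
      using Rats_dense_in_real[OF \<open>r < t\<close>] by blast
    obtain \<delta> where \<delta>: "\<delta> > 0" "ball y \<delta> \<subseteq> U"
      using U open_contains_ball by blast
    \<comment> \<open>With this slope the cone has radius less than \<open>\<delta> / 2\<close>, which leaves room to move the apex
        from \<open>y\<close> to a nearby point \<open>d\<close> of the dense set; \<open>\<eta>\<close> also keeps the loss of height
        at \<open>y\<close> below \<open>s - r\<close>.\<close>
    obtain q :: nat where q: "2 * s / \<delta> < real q"
      using reals_Archimedean2 by blast
    then have q0: "q > 0" using s rt \<delta>
      by (metis divide_nonneg_pos dual_order.strict_trans1 gr0I linorder_not_less mult_nonneg_nonneg of_nat_0 order.strict_implies_order zero_le_numeral)
    define \<eta> where "\<eta> = min (\<delta> / 2) ((s - r) / q)"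
    have \<eta>: "\<eta> > 0" "\<eta> \<le> \<delta> / 2" "real q * \<eta> \<le> s - r"
      using q0 s \<delta> by (auto simp: \<eta>_def min_def field_simps)
    obtain d where d: "d \<in> D" "dist y d < \<eta>"
      using D(2)[of "ball y \<eta>"] \<eta>(1) by auto
    have F: "\<Phi> (d, s, q) \<in> F"
      using d s rt by (auto simp: F_def)
    have "real q * dist d y < real q * \<eta>"
      using d q0 by (simp add: dist_commute)
    then have 1: "r < \<Phi> (d, s, q) y"
      using \<eta>(3) by (simp add: \<Phi>_def)
    have 2: "\<Phi> (d, s, q) z \<le> t" for z
    proof -
      have "0 \<le> real q * dist d z" by simp
      then show ?thesis using s rt unfolding \<Phi>_def by (simp only: prod.case)
    qed
    have 3: "\<Phi> (d, s, q) z = 0" if "z \<notin> U" for z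
    proof -
      have "\<delta> \<le> dist y z" using that \<delta>(2) by (meson linorder_not_le mem_ball subsetD)
      also have "\<dots> \<le> dist y d + dist d z" by (rule dist_triangle)
      finally have "\<delta> / 2 \<le> dist d z" using d(2) \<eta>(2) by simp
      then have "real q * (\<delta> / 2) \<le> real q * dist d z" by (intro mult_left_mono) simp_all
      moreover have "s < real q * (\<delta> / 2)" using q \<delta>(1) by (simp add: field_simps)
      ultimately show ?thesis by (simp add: \<Phi>_def)
    qed
    show "\<exists>\<phi>\<in>F. r < \<phi> y \<and> (\<forall>z. \<phi> z \<le> t) \<and> (\<forall>z. z \<notin> U \<longrightarrow> \<phi> z = 0)"
      using F 1 2 3 by blast
  qed
qed

definition max_of :: "('a \<Rightarrow> real) list \<Rightarrow> 'a \<Rightarrow> real" where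
  "max_of l x = foldr (\<lambda>\<phi> m. max (\<phi> x) m) l 0"

lemma max_of_simps [simp]: "max_of [] x = 0" "max_of (\<phi> # l) x = max (\<phi> x) (max_of l x)"
  by (simp_all add: max_of_def)

lemma continuous_on_max_of:
  fixes l :: "('a::topological_space \<Rightarrow> real) list"
  assumes "\<And>\<phi>. \<phi> \<in> set l \<Longrightarrow> continuous_on UNIV \<phi>"
  shows "continuous_on UNIV (\<lambda>x. max_of l x)"
  using assms by (induction l) (simp_all add: continuous_intros)

lemma max_of_le: "0 \<le> c \<Longrightarrow> (\<And>\<phi>. \<phi> \<in> set l \<Longrightarrow> \<phi> x \<le> c) \<Longrightarrow> max_of l x \<le> c"
  by (induction l) auto

lemma max_of_nonneg: "0 \<le> max_of l x"
  by (induction l) auto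

lemma max_of_ge: "\<phi> \<in> set l \<Longrightarrow> \<phi> x \<le> max_of l x"
  by (induction l) (auto simp: le_max_iff_disj)

text \<open>
  A continuous function with values in \<open>{0..1}\<close> is the pointwise supremum of the bumps below it,
  because it stays above a constant near each point. Closing the bumps under finite maxima turns this
  supremum into a limit of members of one countable family, and such a limit can be
  exchanged with integration.
\<close>
lemma countable_family_approximating_from_below:
  obtains e :: "nat \<Rightarrow> 'a::{metric_space, second_countable_topology} \<Rightarrow> real" where
    "\<And>i. continuous_on UNIV (e i)"
    "\<And>i x. 0 \<le> e i x \<and> e i x \<le> 1"
    "\<And>f :: 'a \<Rightarrow> real. continuous_on UNIV f \<Longrightarrow> (\<And>x. 0 \<le> f x \<and> f x \<le> 1) \<Longrightarrow>
       \<exists>s. (\<forall>m x. e (s m) x \<le> f x) \<and> (\<forall>x. (\<lambda>m. e (s m) x) \<longlonglongrightarrow> f x)"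
proof -
  obtain F :: "('a \<Rightarrow> real) set" where F: "countable F"
    "\<And>\<phi>. \<phi> \<in> F \<Longrightarrow> continuous_on UNIV \<phi>"
    "\<And>\<phi> x. \<phi> \<in> F \<Longrightarrow> 0 \<le> \<phi> x \<and> \<phi> x \<le> 1"
    "\<And>U y r t. open U \<Longrightarrow> y \<in> U \<Longrightarrow> 0 \<le> r \<Longrightarrow> r < t \<Longrightarrow> t \<le> 1 \<Longrightarrow>
       \<exists>\<phi>\<in>F. r < \<phi> y \<and> (\<forall>z. \<phi> z \<le> t) \<and> (\<forall>z. z \<notin> U \<longrightarrow> \<phi> z = 0)"
    using countable_bump_family by blast
  define L where "L = max_of ` lists F"
  have "countable L" "L \<noteq> {}"
    using F(1) by (auto simp: L_def)
  define e where "e = from_nat_into L"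
  have range_e: "range e = L"
    using \<open>countable L\<close> \<open>L \<noteq> {}\<close> by (simp add: e_def)
  have eL: "e i \<in> L" for i using range_e by blast
  show thesis
  proof (rule that)
    show "continuous_on UNIV (e i)" for i
      using eL[of i] F(2) by (auto simp: L_def intro!: continuous_on_max_of)
    show "0 \<le> e i x \<and> e i x \<le> 1" for i x
      using eL[of i] F(3) by (auto simp: L_def max_of_nonneg intro!: max_of_le)
  next
    fix f :: "'a \<Rightarrow> real"
    assume f: "continuous_on UNIV f" "\<And>x. 0 \<le> f x \<and> f x \<le> 1"
    \<comment> \<open>The zero function \<open>max_of []\<close> only makes \<open>G\<close> nonempty, so that it can be enumerated.\<close>
    define G where "G = insert (max_of []) {\<phi> \<in> F. \<forall>x. \<phi> x \<le> f x}"
    have G: "countable G" "G \<noteq> {}"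
      using F(1) by (auto simp: G_def)
    define h where "h = from_nat_into G"
    have range_h: "range h = G" using G by (simp add: h_def)
    have h_le: "h j x \<le> f x" for j x
    proof -
      have "h j \<in> G" using range_h by blast
      then show ?thesis using f(2) by (auto simp: G_def)
    qed
    have max_of_F: "\<exists>l'\<in>lists F. max_of l' = max_of l" if "l \<in> lists G" for l
      using that
    proof (induction l)
      case Nil
      show ?case by (auto intro: bexI[of _ "[]"])
    next
      case (Cons \<phi> l)
      then obtain l' where l': "l' \<in> lists F" "max_of l' = max_of l" by auto
      show ?case
      proof (cases "\<phi> \<in> F")
        case True
        with l' show ?thesis
          by (intro bexI[of _ "\<phi> # l'"]) (auto simp: fun_eq_iff)
      next
        case False
        then have "\<phi> = max_of []" using Cons by (auto simp: G_def)
        with l' show ?thesis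
          by (intro bexI[of _ l']) (auto simp: fun_eq_iff max_of_nonneg)
      qed
    qed
    have "\<exists>i. e i = max_of (map h [0..<m])" for m
    proof -
      have "map h [0..<m] \<in> lists G" using range_h by (auto simp: lists_eq_set)
      from max_of_F[OF this] have "max_of (map h [0..<m]) \<in> L"
        unfolding L_def by (metis imageI)
      then show ?thesis using range_e by (metis imageE)
    qed
    then obtain s where s: "\<And>m. e (s m) = max_of (map h [0..<m])" by metis
    have le: "e (s m) x \<le> f x" for m x
      unfolding s using f(2) h_le by (auto intro!: max_of_le)
    have "(\<lambda>m. e (s m) x) \<longlonglongrightarrow> f x" for x
    proof (rule order_tendstoI)
      fix a assume "a < f x"
      show "\<forall>\<^sub>F m in sequentially. a < e (s m) x"
      proof (cases "a < 0")
        case True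
        then show ?thesis
          unfolding s by (intro always_eventually allI less_le_trans[OF True max_of_nonneg])
      next
        case False
        obtain t where t: "a < t" "t < f x" using dense[OF \<open>a < f x\<close>] by blast
        have "open {z. t < f z}"
          using f(1) by (intro open_Collect_less continuous_intros) auto
        moreover have "t \<le> 1" using t f(2)[of x] by linarith
        ultimately obtain \<phi> where \<phi>: "\<phi> \<in> F" "a < \<phi> x" "\<And>z. \<phi> z \<le> t"
          "\<And>z. z \<notin> {z. t < f z} \<Longrightarrow> \<phi> z = 0"
          using F(4)[of "{z. t < f z}" x a t] t False by auto
        have "\<phi> z \<le> f z" for z
          using \<phi>(3)[of z] \<phi>(4)[of z] f(2)[of z] by (cases "t < f z") auto
        then have "\<phi> \<in> G" using \<phi>(1) by (simp add: G_def)
        then obtain j where j: "h j = \<phi>" using range_h by blast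
        have "a < e (s m) x" if "m \<ge> Suc j" for m
        proof -
          have "\<phi> \<in> set (map h [0..<m])" using that j by auto
          from max_of_ge[OF this, of x] show ?thesis unfolding s using \<phi>(2) by linarith
        qed
        then show ?thesis unfolding eventually_sequentially by blast
      qed
    next
      fix a assume "f x < a"
      then show "\<forall>\<^sub>F m in sequentially. e (s m) x < a"
        by (intro always_eventually allI) (rule le_less_trans[OF le])
    qed
    with le show "\<exists>s. (\<forall>m x. e (s m) x \<le> f x) \<and> (\<forall>x. (\<lambda>m. e (s m) x) \<longlonglongrightarrow> f x)"
      by blast
  qed
qed

section \<open>The weak topology is generated by countably many moments\<close>

definition moments :: "(nat \<Rightarrow> 'a \<Rightarrow> real) \<Rightarrow> 'a measure \<Rightarrow> nat \<Rightarrow> real" where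
  "moments e P i = (\<integral>x. e i x \<partial>P)"

lemma borel_prob_measuresD:
  assumes "P \<in> borel_prob_measures"
  shows "prob_space P" "sets P = sets borel" "space P = UNIV"
  using assms sets_eq_imp_space_eq[of P borel] by (auto simp: borel_prob_measures_def)

lemma continuous_imp_measurable:
  fixes f :: "'a::topological_space \<Rightarrow> real"
  assumes "sets P = sets borel" "continuous_on UNIV f"
  shows "f \<in> borel_measurable P"
  using borel_measurable_continuous_onI[OF assms(2)] assms(1)
  by (simp cong: measurable_cong_sets)

lemma integrable_continuous_bounded:
  fixes f :: "'a::topological_space \<Rightarrow> real"
  assumes P: "P \<in> borel_prob_measures" and f: "continuous_on UNIV f" "\<And>x. \<bar>f x\<bar> \<le> c"
  shows "integrable P f"
proof -
  interpret prob_space P using borel_prob_measuresD(1)[OF P] .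
  show ?thesis
    using f(2) by (intro integrable_const_bound[of _ c] continuous_imp_measurable borel_prob_measuresD(2) P f(1)) auto
qed

lemma continuous_map_weak_integral:
  fixes f :: "'a::topological_space \<Rightarrow> real"
  assumes "continuous_on UNIV f" "bounded (range f)"
  shows "continuous_map weak_topology euclideanreal (\<lambda>P. \<integral>x. f x \<partial>P)"
proof -
  have "openin weak_topology {P \<in> borel_prob_measures. (\<integral>x. f x \<partial>P) \<in> U}" if "open U" for U
    unfolding weak_topology_def by (rule topology_generated_by_Basis) (use assms that in blast)
  then show ?thesis by (auto simp: continuous_map_def)
qed

text \<open>
  Approximation from below makes \<open>P \<mapsto> \<integral>f dP\<close> a supremum of functions that depend
  continuously on the moments, hence lower semicontinuous for the topology pulled back along
  \<open>moments e\<close>. Applying this to affine images of \<open>f\<close> and of \<open>- f\<close> gives continuity for every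
  bounded continuous \<open>f\<close>. The metric of the sequence space thus serves as a metric for weak
  convergence, and it can be evaluated at a sample through its empirical moments.
\<close>
lemma weak_topology_eq_pullback_moments:
  obtains e :: "nat \<Rightarrow> 'a::{metric_space, second_countable_topology} \<Rightarrow> real" where
    "\<And>i. continuous_on UNIV (e i)"
    "\<And>i x. 0 \<le> e i x \<and> e i x \<le> 1"
    "weak_topology = pullback_topology borel_prob_measures (moments e) euclidean"
proof -
  obtain e :: "nat \<Rightarrow> 'a \<Rightarrow> real" where e: "\<And>i. continuous_on UNIV (e i)"
    "\<And>i x. 0 \<le> e i x \<and> e i x \<le> 1"
    "\<And>f :: 'a \<Rightarrow> real. continuous_on UNIV f \<Longrightarrow> (\<And>x. 0 \<le> f x \<and> f x \<le> 1) \<Longrightarrow>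
       \<exists>s. (\<forall>m x. e (s m) x \<le> f x) \<and> (\<forall>x. (\<lambda>m. e (s m) x) \<longlonglongrightarrow> f x)"
    using countable_family_approximating_from_below by blast
  define T where "T = pullback_topology borel_prob_measures (moments e) euclidean"
  have topT: "topspace T = borel_prob_measures"
    by (simp add: T_def topspace_pullback_topology)
  have "continuous_map T euclidean (moments e)"
    using continuous_map_pullback[OF continuous_map_id[of euclidean],
        where A = borel_prob_measures and f = "moments e"]
    by (simp add: T_def)
  then have cont_e: "continuous_map T euclideanreal (\<lambda>P. \<integral>x. e i x \<partial>P)" for i
    using continuous_map_compose[of T euclidean "moments e" euclideanreal "\<lambda>y. y i"]
    by (simp add: o_def moments_def continuous_on_product_coordinates)
  have lsc: "openin T {P \<in> topspace T. a < (\<integral>x. f x \<partial>P)}"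
    if f: "continuous_on UNIV f" "\<And>x. 0 \<le> f x \<and> f x \<le> 1" for f :: "'a \<Rightarrow> real" and a
  proof -
    obtain s where s: "\<And>m x. e (s m) x \<le> f x" "\<And>x. (\<lambda>m. e (s m) x) \<longlonglongrightarrow> f x"
      using e(3)[OF f] by blast
    have "a < (\<integral>x. f x \<partial>P) \<longleftrightarrow> (\<exists>m. a < (\<integral>x. e (s m) x \<partial>P))"
      if P: "P \<in> borel_prob_measures" for P
    proof -
      interpret prob_space P using borel_prob_measuresD(1)[OF P] .
      have int_f: "integrable P f"
        using f by (intro integrable_continuous_bounded[OF P, of _ 1]) auto
      have int_e: "integrable P (e i)" for i
        using e by (intro integrable_continuous_bounded[OF P, of _ 1]) auto
      have "(\<lambda>m. \<integral>x. e (s m) x \<partial>P) \<longlonglongrightarrow> (\<integral>x. f x \<partial>P)"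
        using s(2) e(2) int_f int_e
        by (intro integral_dominated_convergence[where w = "\<lambda>_. 1"]) auto
      moreover have "(\<integral>x. e (s m) x \<partial>P) \<le> (\<integral>x. f x \<partial>P)" for m
        using s(1) int_f int_e by (intro integral_mono) auto
      ultimately show ?thesis
        by (metis (no_types, lifting) eventually_sequentially le_refl less_le_trans order_tendstoD(1))
    qed
    then have "{P \<in> topspace T. a < (\<integral>x. f x \<partial>P)}
             = (\<Union>m. {P \<in> topspace T. a < (\<integral>x. e (s m) x \<partial>P)})"
      by (auto simp: topT)
    moreover have "openin T {P \<in> topspace T. a < (\<integral>x. e i x \<partial>P)}" for i
      using cont_e[of i] by (simp add: continuous_map_upper_lower_semicontinuous_lt)
    ultimately show ?thesis by auto
  qed
  have cont: "continuous_map T euclideanreal (\<lambda>P. \<integral>x. f x \<partial>P)"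
    if f: "continuous_on UNIV f" "bounded (range f)" for f :: "'a \<Rightarrow> real"
  proof -
    obtain c where "c > 0" and c: "\<And>x. \<bar>f x\<bar> \<le> c"
      using f(2) by (auto simp: bounded_pos)
    have bound: "0 \<le> (f x + c) / (2 * c) \<and> (f x + c) / (2 * c) \<le> 1"
      "0 \<le> (c - f x) / (2 * c) \<and> (c - f x) / (2 * c) \<le> 1" for x
      using \<open>c > 0\<close> c[of x] by (auto simp: abs_le_iff)
    have int: "(\<integral>x. (f x + c) / (2 * c) \<partial>P) = ((\<integral>x. f x \<partial>P) + c) / (2 * c)"
      "(\<integral>x. (c - f x) / (2 * c) \<partial>P) = (c - (\<integral>x. f x \<partial>P)) / (2 * c)"
      if P: "P \<in> topspace T" for P
    proof -
      interpret prob_space P using borel_prob_measuresD(1) P by (simp add: topT)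
      have "integrable P f"
        using P f c by (intro integrable_continuous_bounded[of _ _ c]) (auto simp: topT)
      then show "(\<integral>x. (f x + c) / (2 * c) \<partial>P) = ((\<integral>x. f x \<partial>P) + c) / (2 * c)"
        "(\<integral>x. (c - f x) / (2 * c) \<partial>P) = (c - (\<integral>x. f x \<partial>P)) / (2 * c)"
        by (simp_all add: prob_space)
    qed
    have "openin T {P \<in> topspace T. (a + c) / (2 * c) < (\<integral>x. (f x + c) / (2 * c) \<partial>P)}"
      "openin T {P \<in> topspace T. (c - a) / (2 * c) < (\<integral>x. (c - f x) / (2 * c) \<partial>P)}" for a
      using \<open>c > 0\<close> by (intro lsc bound continuous_intros f(1); simp)+
    moreover have "{P \<in> topspace T. (a + c) / (2 * c) < (\<integral>x. (f x + c) / (2 * c) \<partial>P)}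
          = {P \<in> topspace T. a < (\<integral>x. f x \<partial>P)}"
      "{P \<in> topspace T. (c - a) / (2 * c) < (\<integral>x. (c - f x) / (2 * c) \<partial>P)}
          = {P \<in> topspace T. (\<integral>x. f x \<partial>P) < a}" for a
      using \<open>c > 0\<close> by (auto simp only: int divide_less_cancel)
    ultimately have "openin T {P \<in> topspace T. a < (\<integral>x. f x \<partial>P)}"
      "openin T {P \<in> topspace T. (\<integral>x. f x \<partial>P) < a}" for a
      by simp_all
    then show ?thesis by (simp add: continuous_map_upper_lower_semicontinuous_lt)
  qed
  have "openin weak_topology U \<longleftrightarrow> openin T U" for U
  proof
    assume "openin weak_topology U"
    then have "generate_topology_on {{P \<in> borel_prob_measures. (\<integral>x. f x \<partial>P) \<in> U} | (f :: 'a \<Rightarrow> real) U.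
        continuous_on UNIV f \<and> bounded (range f) \<and> open U} U"
      by (simp add: weak_topology_def openin_topology_generated_by_iff)
    then show "openin T U"
    proof induction
      case (UN K)
      then show ?case by (intro openin_Union) auto
    next
      case (Basis s)
      then obtain f :: "'a \<Rightarrow> real" and V where
        "s = {P \<in> topspace T. (\<integral>x. f x \<partial>P) \<in> V}" "continuous_on UNIV f" "bounded (range f)" "open V"
        by (auto simp: topT)
      then show ?case
        using openin_continuous_map_preimage[OF cont] by fastforce
    qed auto
  next
    assume "openin T U"
    then obtain V where V: "open V" "U = moments e -` V \<inter> borel_prob_measures"
      by (auto simp: T_def openin_pullback_topology)
    have "bounded (range (e i))" for i
      using e(2) by (intro boundedI[of _ 1]) auto
    then have "continuous_map weak_topology euclideanreal (\<lambda>P. moments e P i)" for i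
      unfolding moments_def by (intro continuous_map_weak_integral e)
    then have "continuous_map weak_topology euclidean (moments e)"
      unfolding euclidean_product_topology[symmetric] continuous_map_componentwise_UNIV by simp
    then have "openin weak_topology {P \<in> topspace weak_topology. moments e P \<in> V}"
      using V(1) by (intro openin_continuous_map_preimage) auto
    moreover have "{P \<in> topspace weak_topology. moments e P \<in> V} = U"
      using V(2) by auto
    ultimately show "openin weak_topology U" by simp
  qed
  then show thesis
    using that e(1,2) by (metis T_def topology_eq)
qed

section \<open>Concentration of the empirical moments\<close>

lemma prob_space_sample:
  "P \<in> borel_prob_measures \<Longrightarrow> prob_space (\<Pi>\<^sub>M k\<in>{..<n}. P)"
  by (intro prob_space_PiM borel_prob_measuresD)

lemma measurable_sample_component:
  fixes f :: "'a::topological_space \<Rightarrow> real"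
  assumes "sets P = sets borel" "continuous_on UNIV f" "k < n"
  shows "(\<lambda>x. f (x k)) \<in> borel_measurable (\<Pi>\<^sub>M k\<in>{..<n}. P)"
proof -
  have "(\<lambda>x. x k) \<in> measurable (\<Pi>\<^sub>M k\<in>{..<n}. P) P"
    using assms(3) by (intro measurable_component_singleton) simp
  then show ?thesis
    by (rule measurable_compose) (rule continuous_imp_measurable[OF assms(1,2)])
qed

lemma integral_sample_prod:
  fixes f :: "nat \<Rightarrow> 'a::topological_space \<Rightarrow> real"
  assumes P: "P \<in> borel_prob_measures" and f: "\<And>k. k < n \<Longrightarrow> integrable P (f k)"
  shows "(\<integral>x. (\<Prod>k<n. f k (x k)) \<partial>(\<Pi>\<^sub>M k\<in>{..<n}. P)) = (\<Prod>k<n. \<integral>x. f k x \<partial>P)"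
proof -
  interpret product_prob_space "\<lambda>_::nat. P"
    by (intro product_prob_spaceI borel_prob_measuresD(1)[OF P])
  show ?thesis
    using f by (intro product_integral_prod) auto
qed

lemma second_moment_centred_sum:
  fixes g :: "'a::topological_space \<Rightarrow> real"
  assumes P: "P \<in> borel_prob_measures"
    and g: "continuous_on UNIV g" "\<And>x. \<bar>g x\<bar> \<le> 1" "(\<integral>x. g x \<partial>P) = 0"
  shows "(\<integral>x. (\<Sum>k<n. g (x k))\<^sup>2 \<partial>(\<Pi>\<^sub>M k\<in>{..<n}. P)) \<le> real n"
proof -
  interpret P: prob_space P using borel_prob_measuresD(1)[OF P] .
  let ?M = "\<Pi>\<^sub>M k\<in>{..<n}. P"
  interpret M: prob_space ?M using prob_space_sample[OF P] .
  have bound: "\<bar>g a * g b\<bar> \<le> 1" for a b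
    using mult_mono[OF g(2)[of a] g(2)[of b]] by (simp add: abs_mult)
  have int: "integrable ?M (\<lambda>x. g (x i) * g (x j))" if "i < n" "j < n" for i j
    using bound that measurable_sample_component[OF borel_prob_measuresD(2)[OF P] g(1)]
    by (intro M.integrable_const_bound[of _ 1]) (auto intro!: borel_measurable_times)
  have int_g: "integrable P (\<lambda>x. g x)" and int_gg: "integrable P (\<lambda>x. g x * g x)"
    using g(1,2) bound by (auto intro!: integrable_continuous_bounded[OF P, of _ 1] continuous_intros)
  \<comment> \<open>Writing the product of two coordinates as a product over all coordinates lets independence apply
      to the cases \<open>i = j\<close> and \<open>i \<noteq> j\<close> alike.\<close>
  have eq: "(\<integral>x. g (x i) * g (x j) \<partial>?M)
      = (\<Prod>k<n. \<integral>y. (if k = i then g y else 1) * (if k = j then g y else 1) \<partial>P)"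
    if "i < n" "j < n" for i j
  proof -
    have "integrable P (\<lambda>y. (if k = i then g y else 1) * (if k = j then g y else 1))" for k
      using int_g int_gg by (cases "k = i"; cases "k = j") simp_all
    from integral_sample_prod[OF P, of n "\<lambda>k y. (if k = i then g y else 1) * (if k = j then g y else 1)", OF this]
    show ?thesis
      using that by (simp add: prod.distrib prod.delta)
  qed
  have off_diagonal: "(\<integral>x. g (x i) * g (x j) \<partial>?M) = 0" if "i < n" "j < n" "i \<noteq> j" for i j
    unfolding eq[OF that(1,2)] using that g(3) by (intro prod_zero) (auto intro!: bexI[of _ i])
  have diagonal: "(\<integral>x. g (x i) * g (x i) \<partial>?M) \<le> 1" if "i < n" for i
  proof -
    have "(\<integral>x. g (x i) * g (x i) \<partial>?M) \<le> (\<integral>x. 1 \<partial>?M)"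
      using int[OF that that] bound by (intro integral_mono) (auto simp: abs_le_iff)
    then show ?thesis by (simp add: M.prob_space)
  qed
  have "(\<integral>x. (\<Sum>k<n. g (x k))\<^sup>2 \<partial>?M) = (\<Sum>i<n. \<Sum>j<n. \<integral>x. g (x i) * g (x j) \<partial>?M)"
  proof -
    have "(\<integral>x. (\<Sum>k<n. g (x k))\<^sup>2 \<partial>?M) = (\<integral>x. (\<Sum>i<n. \<Sum>j<n. g (x i) * g (x j)) \<partial>?M)"
      by (simp add: power2_eq_square sum_product)
    also have "\<dots> = (\<Sum>i<n. \<integral>x. (\<Sum>j<n. g (x i) * g (x j)) \<partial>?M)"
      by (intro Bochner_Integration.integral_sum Bochner_Integration.integrable_sum int) auto
    also have "\<dots> = (\<Sum>i<n. \<Sum>j<n. \<integral>x. g (x i) * g (x j) \<partial>?M)"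
      by (intro sum.cong refl Bochner_Integration.integral_sum int) auto
    finally show ?thesis .
  qed
  also have "\<dots> \<le> (\<Sum>i<n. \<Sum>j<n. if j = i then 1 else 0)"
    using off_diagonal diagonal by (intro sum_mono) auto
  also have "\<dots> = real n"
    by simp
  finally show ?thesis .
qed

text \<open>
  The bound depends neither on \<open>P\<close> nor on \<open>f\<close>. This uniformity permits one deterministic
  sequence of radii for all measures and all coordinates.
\<close>
lemma expected_deviation_of_sample_mean:
  fixes f :: "'a::topological_space \<Rightarrow> real" and n :: nat
  assumes P: "P \<in> borel_prob_measures"
    and f: "continuous_on UNIV f" "\<And>x. 0 \<le> f x \<and> f x \<le> 1" and n: "n \<ge> 1"
  shows "(\<integral>x. \<bar>(\<Sum>k<n. f (x k)) / n - (\<integral>y. f y \<partial>P)\<bar> \<partial>(\<Pi>\<^sub>M k\<in>{..<n}. P)) \<le> 1 / sqrt n"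
proof -
  interpret P: prob_space P using borel_prob_measuresD(1)[OF P] .
  let ?M = "\<Pi>\<^sub>M k\<in>{..<n}. P"
  interpret M: prob_space ?M using prob_space_sample[OF P] .
  define \<mu> where "\<mu> = (\<integral>y. f y \<partial>P)"
  have int_f: "integrable P f"
    using f by (intro integrable_continuous_bounded[OF P, of _ 1]) auto
  have \<mu>: "0 \<le> \<mu>" "\<mu> \<le> 1"
    using integral_mono[of P f "\<lambda>_. 1"] f(2) int_f
    by (auto simp: \<mu>_def P.prob_space intro!: Bochner_Integration.integral_nonneg)
  define g where "g = (\<lambda>y. f y - \<mu>)"
  have g: "continuous_on UNIV g" "\<And>x. \<bar>g x\<bar> \<le> 1" "(\<integral>x. g x \<partial>P) = 0"
  proof -
    show "continuous_on UNIV g" unfolding g_def by (intro continuous_intros f)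
    show "\<bar>g x\<bar> \<le> 1" for x using f(2)[of x] \<mu> by (auto simp: g_def abs_le_iff)
    show "(\<integral>x. g x \<partial>P) = 0" using int_f by (simp add: g_def P.prob_space \<mu>_def)
  qed
  define S where "S = (\<lambda>x. \<Sum>k<n. g (x k))"
  have [measurable]: "S \<in> borel_measurable ?M"
    unfolding S_def using measurable_sample_component[OF borel_prob_measuresD(2)[OF P] g(1)] by (intro borel_measurable_sum) auto
  have S_le: "\<bar>S x\<bar> \<le> n" for x
  proof -
    have "\<bar>S x\<bar> \<le> (\<Sum>k<n. \<bar>g (x k)\<bar>)" unfolding S_def by (rule sum_abs)
    also have "\<dots> \<le> (\<Sum>k<n. 1)" by (intro sum_mono g(2))
    finally show ?thesis by simp
  qed
  have int_S: "integrable ?M (\<lambda>x. \<bar>S x\<bar>)" "integrable ?M (\<lambda>x. (S x)\<^sup>2)"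
  proof -
    show "integrable ?M (\<lambda>x. \<bar>S x\<bar>)"
      using S_le by (intro M.integrable_const_bound[of _ n]) auto
    have "(S x)\<^sup>2 \<le> (real n)\<^sup>2" for x using S_le[of x] by (simp add: abs_le_square_iff[symmetric])
    then show "integrable ?M (\<lambda>x. (S x)\<^sup>2)"
      by (intro M.integrable_const_bound[of _ "(real n)\<^sup>2"]) auto
  qed
  have mean: "(\<Sum>k<n. f (x k)) / n - \<mu> = S x / n" for x
    using n by (simp add: S_def g_def sum_subtractf field_simps)
  \<comment> \<open>The quadratic bound is the arithmetic-geometric mean inequality for \<open>s * s\<close> and \<open>a * a\<close>;
      it is tight where \<open>a\<close> has its typical size \<open>s = sqrt n\<close>.\<close>
  have amgm: "\<bar>a\<bar> \<le> (sqrt n + a\<^sup>2 / sqrt n) / 2" for a :: real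
  proof -
    define s where "s = sqrt n"
    have "s > 0" using n by (simp add: s_def)
    have "0 \<le> (s - \<bar>a\<bar>)\<^sup>2" by simp
    also have "\<dots> = s\<^sup>2 + a\<^sup>2 - 2 * s * \<bar>a\<bar>" by (simp add: power2_diff)
    finally show ?thesis using \<open>s > 0\<close>
      unfolding s_def[symmetric] by (simp add: field_simps power2_eq_square)
  qed
  have "(\<integral>x. \<bar>S x\<bar> \<partial>?M) \<le> (\<integral>x. (sqrt n + (S x)\<^sup>2 / sqrt n) / 2 \<partial>?M)"
    using int_S amgm by (intro integral_mono) auto
  also have "\<dots> = (sqrt n + (\<integral>x. (S x)\<^sup>2 \<partial>?M) / sqrt n) / 2"
    using int_S by (simp add: M.prob_space)
  also have "\<dots> \<le> (sqrt n + n / sqrt n) / 2"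
    using second_moment_centred_sum[OF P g, of n] unfolding S_def
    by (intro divide_right_mono add_left_mono) auto
  also have "\<dots> = sqrt n"
    by (simp add: real_div_sqrt)
  finally have "(\<integral>x. \<bar>S x\<bar> \<partial>?M) / n \<le> sqrt n / n"
    by (intro divide_right_mono) auto
  also have "sqrt n / n = 1 / sqrt n"
    using n by (simp add: divide_simps)
  finally show ?thesis
    unfolding \<mu>_def[symmetric] mean by simp
qed

definition empirical_moments :: "(nat \<Rightarrow> 'a \<Rightarrow> real) \<Rightarrow> nat \<Rightarrow> (nat \<Rightarrow> 'a) \<Rightarrow> nat \<Rightarrow> real" where
  "empirical_moments e n x i = (\<Sum>k<n. e i (x k)) / real n"

lemma continuous_map_empirical_moments:
  assumes "\<And>i. continuous_on UNIV (e i)"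
  shows "continuous_map (product_topology (\<lambda>_. euclidean) {..<n}) euclidean (empirical_moments e n)"
proof -
  have "continuous_map (product_topology (\<lambda>_. euclidean) {..<n}) euclideanreal (\<lambda>x. e i (x k))"
    if "k < n" for i k
    using continuous_map_compose[OF continuous_map_product_projection[of k "{..<n}" "\<lambda>_. euclidean"],
        of euclideanreal "e i"] assms[of i] that by (simp add: o_def)
  then have "continuous_map (product_topology (\<lambda>_. euclidean) {..<n}) euclideanreal
      (\<lambda>x. empirical_moments e n x i)" for i
    unfolding empirical_moments_def divide_inverse
    by (intro continuous_map_real_mult continuous_map_sum) auto
  then show ?thesis
    unfolding euclidean_product_topology[symmetric] continuous_map_componentwise_UNIV by simp
qed

lemma measurable_empirical_moments:
  fixes e :: "nat \<Rightarrow> 'a::topological_space \<Rightarrow> real"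
  assumes "sets P = sets borel" and "\<And>i. continuous_on UNIV (e i)"
  shows "empirical_moments e n \<in> borel_measurable (\<Pi>\<^sub>M k\<in>{..<n}. P)"
  using measurable_sample_component[OF assms]
  by (intro measurable_coordinatewise_then_product)
    (auto simp: empirical_moments_def intro!: borel_measurable_divide borel_measurable_sum)

text \<open>
  The metric on sequences is a sum of coordinate distances with weights \<open>(1/2)^i\<close>, so the uniform
  bound on the expected coordinate deviations passes to the expected distance with the factor
  \<open>2\<close>, the sum of the weights. Markov's inequality does the rest.
\<close>
lemma empirical_moments_concentrate:
  fixes e :: "nat \<Rightarrow> 'a::topological_space \<Rightarrow> real"
  assumes P: "P \<in> borel_prob_measures"
    and e: "\<And>i. continuous_on UNIV (e i)" "\<And>i x. 0 \<le> e i x \<and> e i x \<le> 1"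
    and n: "n \<ge> 1" and c: "c > 0"
  shows "measure (\<Pi>\<^sub>M k\<in>{..<n}. P)
      {x \<in> space (\<Pi>\<^sub>M k\<in>{..<n}. P). c \<le> dist (empirical_moments e n x) (moments e P)}
    \<le> (2 / sqrt n) / c"
proof -
  let ?M = "\<Pi>\<^sub>M k\<in>{..<n}. P"
  interpret M: prob_space ?M using prob_space_sample[OF P] .
  define D where "D x = dist (empirical_moments e n x) (moments e P)" for x
  define d where "d i x = dist (empirical_moments e n x (from_nat i)) (moments e P (from_nat i))" for i x
  have [measurable]: "empirical_moments e n \<in> borel_measurable ?M"
    by (rule measurable_empirical_moments[OF borel_prob_measuresD(2)[OF P] e(1)])
  have D_meas[measurable]: "D \<in> borel_measurable ?M"
    unfolding D_def by measurable
  have d_nonneg: "0 \<le> d i x" for i x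
    by (simp add: d_def)
  have [measurable]: "d i \<in> borel_measurable ?M" for i
    using measurable_sample_component[OF borel_prob_measuresD(2)[OF P] e(1)] unfolding d_def empirical_moments_def
    by (intro borel_measurable_dist borel_measurable_divide borel_measurable_sum) auto
  \<comment> \<open>The metric on \<open>'i \<Rightarrow> 'b\<close> for countable \<open>'i\<close> lists the coordinates by \<open>from_nat\<close>, which
      need not be the identity for \<open>'i = nat\<close>; all coordinates obey the same bound, so their order
      is immaterial.\<close>
  have summable: "summable (\<lambda>i. (1/2)^i * min (d i x) 1)" for x
    by (rule summable_comparison_test'[of "\<lambda>n. (1/2)^n"])
      (auto simp: summable_geometric_iff d_def)
  have D_eq: "D x = (\<Sum>i. (1/2)^i * min (d i x) 1)" for x
    unfolding D_def d_def dist_fun_def by simp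
  have D_le: "D x \<le> 2" for x
  proof -
    have "D x \<le> (\<Sum>i. (1/2)^i)"
      unfolding D_eq using summable by (intro suminf_le) (auto simp: summable_geometric_iff)
    then show ?thesis by (simp add: suminf_geometric)
  qed
  have int_D: "integrable ?M D"
    using D_le by (intro M.integrable_const_bound[of _ 2]) (auto simp: D_def)
  have d_le: "(\<integral>\<^sup>+x. ennreal (min (d i x) 1) \<partial>?M) \<le> ennreal (1 / sqrt n)" for i
  proof -
    let ?j = "from_nat i :: nat"
    have int: "integrable ?M (\<lambda>x. min (d i x) 1)"
    proof (rule M.integrable_const_bound[of _ 1])
      show "AE x in ?M. norm (min (d i x) 1) \<le> 1" by (auto simp: d_def)
    qed simp
    have d_int: "integrable ?M (d i)"
    proof (rule M.integrable_const_bound[of _ 1])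
      have int_e: "integrable P (e ?j)"
        using e by (intro integrable_continuous_bounded[OF P, of _ 1]) auto
      interpret P: prob_space P using borel_prob_measuresD(1)[OF P] .
      have "0 \<le> moments e P ?j" "moments e P ?j \<le> 1"
        using integral_mono[of P "e ?j" "\<lambda>_. 1"] e(2) int_e
        by (auto simp: moments_def P.prob_space intro!: Bochner_Integration.integral_nonneg)
      moreover have "0 \<le> empirical_moments e n x ?j" "empirical_moments e n x ?j \<le> 1" for x
        using n e(2) sum_mono[of "{..<n}" "\<lambda>k. e ?j (x k)" "\<lambda>_. 1"]
        by (auto simp: empirical_moments_def intro!: sum_nonneg divide_nonneg_nonneg)
      ultimately show "AE x in ?M. norm (d i x) \<le> 1"
        unfolding d_def dist_real_def by (intro AE_I2) (smt (verit) real_norm_def)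
    qed simp
    have "(\<integral>x. min (d i x) 1 \<partial>?M) \<le> (\<integral>x. d i x \<partial>?M)"
      using int d_int by (intro integral_mono) auto
    also have "\<dots> \<le> 1 / sqrt n"
      using expected_deviation_of_sample_mean[OF P e(1,2) n, of ?j]
      by (simp add: d_def dist_real_def empirical_moments_def moments_def)
    finally show ?thesis
      using int by (subst nn_integral_eq_integral) (auto simp: d_def ennreal_leI)
  qed
  have "ennreal (\<integral>x. D x \<partial>?M) = (\<integral>\<^sup>+x. ennreal (D x) \<partial>?M)"
    by (intro nn_integral_eq_integral[symmetric] int_D AE_I2) (simp add: D_def)
  also have "\<dots> = (\<integral>\<^sup>+x. (\<Sum>i. ennreal ((1/2)^i * min (d i x) 1)) \<partial>?M)"
    unfolding D_eq using summable
    by (intro nn_integral_cong suminf_ennreal2[symmetric]) (auto simp: d_def)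
  also have "\<dots> = (\<Sum>i. \<integral>\<^sup>+x. ennreal ((1/2)^i * min (d i x) 1) \<partial>?M)"
    by (intro nn_integral_suminf) measurable
  also have "\<dots> = (\<Sum>i. ennreal ((1/2)^i) * (\<integral>\<^sup>+x. ennreal (min (d i x) 1) \<partial>?M))"
    by (subst nn_integral_cmult[symmetric]) (auto simp: d_nonneg ennreal_mult)
  also have "\<dots> \<le> (\<Sum>i. ennreal ((1/2)^i) * ennreal (1 / sqrt n))"
    using d_le by (intro suminf_le mult_left_mono) auto
  also have "\<dots> = (\<Sum>i. ennreal ((1/2)^i * (1 / sqrt n)))"
    by (subst ennreal_mult) auto
  also have "\<dots> = ennreal (\<Sum>i. (1/2)^i * (1 / sqrt n))"
    by (intro suminf_ennreal2 summable_mult2) (auto simp: summable_geometric_iff)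
  also have "(\<Sum>i. (1/2)^i * (1 / sqrt n)) = 2 / sqrt n"
    by (subst suminf_mult2[symmetric]) (auto simp: summable_geometric_iff suminf_geometric)
  finally have "(\<integral>x. D x \<partial>?M) \<le> 2 / sqrt n"
    by (subst (asm) ennreal_le_iff) auto
  then have "(\<integral>x. D x \<partial>?M) / c \<le> (2 / sqrt n) / c"
    using c by (intro divide_right_mono) auto
  moreover have "measure ?M {x \<in> space ?M. c \<le> D x} \<le> (\<integral>x. D x \<partial>?M) / c"
    by (intro int_D c integral_Markov_inequality_measure[where A = "{}"] AE_I2) (simp_all add: D_def)
  ultimately show ?thesis by (simp add: D_def)
qed

section \<open>Tests from sequences of closed sets\<close>

definition thicken :: "'a::metric_space set \<Rightarrow> real \<Rightarrow> 'a set" where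
  "thicken S r = (\<Union>z\<in>S. ball z r)"

lemma open_thicken [simp]: "open (thicken S r)"
  by (auto simp: thicken_def)

lemma thicken_mono: "S \<subseteq> T \<Longrightarrow> thicken S r \<subseteq> thicken T r"
  by (auto simp: thicken_def)

text \<open>
  A point outside a closed set keeps a positive distance from it, so small balls around the point
  miss all small thickenings of the set. Removing the closure of the thickening keeps the region open.
\<close>
lemma ball_subset_thicken_minus:
  fixes y :: "'a::metric_space"
  assumes "y \<in> S" "closed F" "y \<notin> F" "G \<subseteq> F"
  shows "\<exists>\<delta>>0. \<forall>r<\<delta>. ball y r \<subseteq> thicken S r - closure (thicken G r)"
proof -
  obtain d where d: "d > 0" "ball y d \<subseteq> - F"
    using assms open_contains_ball[of "- F"] by (metis ComplI open_Compl)
  have "ball y r \<subseteq> thicken S r - closure (thicken G r)" if "r < d / 2" for r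
  proof -
    have "ball y r \<inter> thicken G r = {}"
    proof (rule ccontr)
      assume "ball y r \<inter> thicken G r \<noteq> {}"
      then obtain x z where x: "dist y x < r" "z \<in> G" "dist z x < r"
        by (auto simp: thicken_def)
      then have "dist y z < d"
        using that dist_triangle[of y z x] by (simp add: dist_commute)
      then have "z \<notin> F" using d by auto
      then show False using x assms by blast
    qed
    then have "ball y r \<inter> closure (thicken G r) = {}"
      by (simp add: open_Int_closure_eq_empty)
    moreover have "ball y r \<subseteq> thicken S r"
      using assms(1) by (auto simp: thicken_def)
    ultimately show ?thesis by blast
  qed
  with d show ?thesis by (intro exI[of _ "d / 2"]) auto
qed

text \<open>
  The fourth root balances two demands: the radius must tend to \<open>0\<close>, and it must dominate the
  deviation, of order \<open>1 / sqrt n\<close>, of the empirical moments. The failure probability is then at most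
  \<open>2 * resolution n\<close>.
\<close>
definition resolution :: "nat \<Rightarrow> real" where
  "resolution n = 1 / sqrt (sqrt n)"

lemma resolution_tendsto_0: "resolution \<longlonglongrightarrow> 0"
  unfolding resolution_def
  by (intro tendsto_divide_0[OF tendsto_const] filterlim_at_top_imp_at_infinity
      filterlim_compose[OF sqrt_at_top] filterlim_real_sequentially)

lemma consistent_if_region_contains_balls:
  fixes e :: "nat \<Rightarrow> 'a::topological_space \<Rightarrow> real"
  assumes P: "P \<in> borel_prob_measures"
    and e: "\<And>i. continuous_on UNIV (e i)" "\<And>i x. 0 \<le> e i x \<and> e i x \<le> 1"
    and R: "\<And>n. open (R n)" "\<delta> > 0" "\<And>n. resolution n < \<delta> \<Longrightarrow> ball (moments e P) (resolution n) \<subseteq> R n"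
    and \<phi>: "\<And>n. verdict_region \<phi> n v = {x \<in> {..<n} \<rightarrow>\<^sub>E UNIV. empirical_moments e n x \<in> R n}"
  shows "consistent_at \<phi> v P"
proof -
  let ?M = "\<lambda>n. \<Pi>\<^sub>M k\<in>{..<n}. P"
  have lower: "1 - 2 * resolution n \<le> measure (?M n) (verdict_region \<phi> n v)"
    if n: "n \<ge> 1" "resolution n < \<delta>" for n
  proof -
    interpret M: prob_space "?M n" using prob_space_sample[OF P] .
    have space: "space (?M n) = {..<n} \<rightarrow>\<^sub>E UNIV"
      by (simp add: space_PiM borel_prob_measuresD(3)[OF P])
    have [measurable]: "empirical_moments e n \<in> borel_measurable (?M n)"
      by (rule measurable_empirical_moments[OF borel_prob_measuresD(2)[OF P] e(1)])
    have [measurable]: "R n \<in> sets borel" using R(1) by simp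
    let ?far = "{x \<in> space (?M n). resolution n \<le> dist (empirical_moments e n x) (moments e P)}"
    have pos: "resolution n > 0" using n by (simp add: resolution_def)
    have far: "?far \<in> M.events" by measurable
    have region: "verdict_region \<phi> n v \<in> M.events"
      unfolding \<phi> space[symmetric] by measurable
    have "space (?M n) - ?far \<subseteq> verdict_region \<phi> n v"
    proof
      fix x assume "x \<in> space (?M n) - ?far"
      then have "x \<in> space (?M n)" "empirical_moments e n x \<in> ball (moments e P) (resolution n)"
        by (auto simp: dist_commute not_le)
      then show "x \<in> verdict_region \<phi> n v"
        using R(3)[OF n(2)] unfolding \<phi> space[symmetric] by blast
    qed
    then have "1 - M.prob ?far \<le> M.prob (verdict_region \<phi> n v)"
      using M.finite_measure_mono[OF _ region, of "space (?M n) - ?far"] M.prob_compl[OF far] by linarith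
    moreover have "M.prob ?far \<le> (2 / sqrt n) / resolution n"
      by (rule empirical_moments_concentrate[OF P e n(1) pos])
    moreover have "(2 / sqrt n) / resolution n = 2 * resolution n"
      using n by (simp add: resolution_def divide_simps)
    ultimately show ?thesis by simp
  qed
  have "\<forall>\<^sub>F n in sequentially. 1 - 2 * resolution n \<le> measure (?M n) (verdict_region \<phi> n v)"
    using order_tendstoD(2)[OF resolution_tendsto_0 R(2)] eventually_ge_at_top[of 1]
    by eventually_elim (rule lower)
  moreover have "\<forall>\<^sub>F n in sequentially. measure (?M n) (verdict_region \<phi> n v) \<le> 1"
    by (intro always_eventually allI prob_space.prob_le_1 prob_space_sample P)
  moreover have "(\<lambda>n. 1 - 2 * resolution n) \<longlonglongrightarrow> 1"
    using tendsto_diff[OF tendsto_const[of 1] tendsto_mult[OF tendsto_const[of 2] resolution_tendsto_0]] by simp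
  ultimately show ?thesis
    unfolding consistent_at_def by (rule tendsto_sandwich[OF _ _ _ tendsto_const])
qed

text \<open>
  The test runs through the list \<open>A 0, B 0, A 1, B 1, \<dots>\<close> and returns the side of the first set
  within \<open>resolution n\<close> of the empirical moments. For a measure \<open>P\<close> in \<open>A k\<close> all earlier sets of
  the other side are closed and miss \<open>moments e P\<close>, hence are eventually out of reach, while
  \<open>A k\<close> itself is within reach with probability tending to \<open>1\<close>. The sets need to be
  disjoint only on the image of \<open>W\<close>, so they are first intersected with that image, which loses
  closedness but keeps them inside closed sets. Acceptance regions are open because the earlier sets
  are excluded through closures of their thickenings.
\<close>
lemma finite_precision_test_of_closed_sequences:
  fixes e :: "nat \<Rightarrow> 'a::topological_space \<Rightarrow> real"
  assumes W: "W \<subseteq> borel_prob_measures"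
    and e: "\<And>i. continuous_on UNIV (e i)" "\<And>i x. 0 \<le> e i x \<and> e i x \<le> 1"
    and closed: "\<And>k. closed (A k)" "\<And>k. closed (B k)"
    and disj: "moments e ` W \<inter> (\<Union>k::nat. A k) \<inter> (\<Union>k::nat. B k) = {}"
  obtains \<phi> where "is_test \<phi>" "finite_precision \<phi>"
    "\<And>P. P \<in> W \<Longrightarrow> moments e P \<in> (\<Union>k. A k) \<Longrightarrow> consistent_at \<phi> Accept0 P"
    "\<And>P. P \<in> W \<Longrightarrow> moments e P \<in> (\<Union>k. B k) \<Longrightarrow> consistent_at \<phi> Accept1 P"
proof -
  define Y where "Y = moments e ` W"
  define R0 where "R0 n = (\<Union>k. thicken (A k \<inter> Y) (resolution n)
     - closure (thicken ((\<Union>j<k. B j) \<inter> Y) (resolution n)))" for n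
  define R1 where "R1 n = (\<Union>k. thicken (B k \<inter> Y) (resolution n)
     - closure (thicken ((\<Union>j\<le>k. A j) \<inter> Y) (resolution n)))" for n
  have open_R: "open (R0 n)" "open (R1 n)" for n
    unfolding R0_def R1_def by (intro open_UN ballI open_Diff open_thicken closed_closure)+
  have disjoint: "R0 n \<inter> R1 n = {}" for n
  proof (rule ccontr)
    assume "R0 n \<inter> R1 n \<noteq> {}"
    then obtain y k l where
      y0: "y \<in> thicken (A k \<inter> Y) (resolution n)"
        "y \<notin> thicken ((\<Union>j<k. B j) \<inter> Y) (resolution n)" and
      y1: "y \<in> thicken (B l \<inter> Y) (resolution n)"
        "y \<notin> thicken ((\<Union>j\<le>l. A j) \<inter> Y) (resolution n)"
      using closure_subset unfolding R0_def R1_def by blast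
    show False
    proof (cases "l < k")
      case True
      then have "B l \<inter> Y \<subseteq> (\<Union>j<k. B j) \<inter> Y" by blast
      with y0(2) y1(1) show False using thicken_mono by blast
    next
      case False
      then have "A k \<inter> Y \<subseteq> (\<Union>j\<le>l. A j) \<inter> Y" by force
      with y0(1) y1(2) show False using thicken_mono by blast
    qed
  qed
  define \<phi> where "\<phi> n x = (if empirical_moments e n x \<in> R0 n then Accept0
      else if empirical_moments e n x \<in> R1 n then Accept1 else Undecided)" for n x
  have region: "verdict_region \<phi> n Accept0 = {x \<in> {..<n} \<rightarrow>\<^sub>E UNIV. empirical_moments e n x \<in> R0 n}"
    "verdict_region \<phi> n Accept1 = {x \<in> {..<n} \<rightarrow>\<^sub>E UNIV. empirical_moments e n x \<in> R1 n}" for n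
    using disjoint[of n] by (auto simp: verdict_region_def \<phi>_def)
  show thesis
  proof (rule that)
    show "is_test \<phi>"
      unfolding is_test_def
    proof (intro allI impI)
      fix n :: nat
      have [measurable]: "empirical_moments e n \<in> borel_measurable (\<Pi>\<^sub>M k\<in>{..<n}. borel)"
        by (rule measurable_empirical_moments[OF refl e(1)])
      have [measurable]: "R0 n \<in> sets borel" "R1 n \<in> sets borel"
        using open_R by auto
      show "\<phi> n \<in> measurable (\<Pi>\<^sub>M i\<in>{..<n}. borel) (count_space UNIV)"
        unfolding \<phi>_def[abs_def] by measurable
    qed
    have "openin (product_topology (\<lambda>_. euclidean) {..<n})
        {x \<in> {..<n} \<rightarrow>\<^sub>E UNIV. empirical_moments e n x \<in> R}" if "open R" for n R
      using openin_continuous_map_preimage[OF continuous_map_empirical_moments[OF e(1)], of R n] that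
      by (simp add: topspace_product_topology)
    then show "finite_precision \<phi>"
      using open_R by (auto simp: finite_precision_def region)
  next
    fix P assume P: "P \<in> W" "moments e P \<in> (\<Union>k. A k)"
    then obtain k where k: "moments e P \<in> A k \<inter> Y" by (auto simp: Y_def)
    have "moments e P \<notin> (\<Union>j<k. B j)"
      using P disj by blast
    then obtain \<delta> where \<delta>: "\<delta> > 0" "\<And>r. r < \<delta> \<Longrightarrow> ball (moments e P) r
        \<subseteq> thicken (A k \<inter> Y) r - closure (thicken ((\<Union>j<k. B j) \<inter> Y) r)"
      using ball_subset_thicken_minus[OF k _ _ Int_lower1] closed by (metis closed_UN finite_lessThan)
    show "consistent_at \<phi> Accept0 P"
    proof (rule consistent_if_region_contains_balls[OF _ e open_R(1) \<delta>(1) _ region(1)])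
      show "ball (moments e P) (resolution n) \<subseteq> R0 n" if "resolution n < \<delta>" for n
        using \<delta>(2)[OF that] unfolding R0_def by blast
    qed (use P W in auto)
  next
    fix P assume P: "P \<in> W" "moments e P \<in> (\<Union>k. B k)"
    then obtain k where k: "moments e P \<in> B k \<inter> Y" by (auto simp: Y_def)
    have "moments e P \<notin> (\<Union>j\<le>k. A j)"
      using P disj by blast
    then obtain \<delta> where \<delta>: "\<delta> > 0" "\<And>r. r < \<delta> \<Longrightarrow> ball (moments e P) r
        \<subseteq> thicken (B k \<inter> Y) r - closure (thicken ((\<Union>j\<le>k. A j) \<inter> Y) r)"
      using ball_subset_thicken_minus[OF k _ _ Int_lower1] closed by (metis closed_UN finite_atMost)
    show "consistent_at \<phi> Accept1 P"
    proof (rule consistent_if_region_contains_balls[OF _ e open_R(2) \<delta>(1) _ region(2)])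
      show "ball (moments e P) (resolution n) \<subseteq> R1 n" if "resolution n < \<delta>" for n
        using \<delta>(2)[OF that] unfolding R1_def by blast
    qed (use P W in auto)
  qed
qed

section \<open>Sample measures of open sets are lower semicontinuous\<close>

text \<open>
  The linear span of products of functions of single observations. On it, integration
  against \<open>P\<^sup>n\<close> is a polynomial in integrals against \<open>P\<close>, hence weakly continuous in \<open>P\<close>.
\<close>
inductive_set sample_polynomials :: "nat \<Rightarrow> ((nat \<Rightarrow> 'a::topological_space) \<Rightarrow> real) set"
  for n where
  prod: "(\<And>k. continuous_on UNIV (f k)) \<Longrightarrow> (\<And>k. bounded (range (f k))) \<Longrightarrow>
    (\<lambda>x. \<Prod>k<n. f k (x k)) \<in> sample_polynomials n"
| linear: "g \<in> sample_polynomials n \<Longrightarrow> h \<in> sample_polynomials n \<Longrightarrow>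
    (\<lambda>x. g x + c * h x) \<in> sample_polynomials n"

lemma sample_polynomials_mult_prod:
  assumes "g \<in> sample_polynomials n"
    and f: "\<And>k. continuous_on UNIV (f k)" "\<And>k. bounded (range (f k))"
  shows "(\<lambda>x. g x * (\<Prod>k<n. f k (x k))) \<in> sample_polynomials n"
  using assms(1)
proof induction
  case (prod f')
  have "bounded (range (\<lambda>y. f' k y * f k y))" for k
  proof -
    obtain b b' where b: "\<And>y. \<bar>f k y\<bar> \<le> b" "\<And>y. \<bar>f' k y\<bar> \<le> b'"
      using f(2)[of k] prod(2)[of k] by (auto simp: bounded_iff)
    have "\<bar>f' k y * f k y\<bar> \<le> b' * b" for y
      unfolding abs_mult using b(1)[of y] b(2)[of y] by (intro mult_mono) auto
    then show ?thesis by (auto simp: bounded_iff)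
  qed
  then have "(\<lambda>x. \<Prod>k<n. f' k (x k) * f k (x k)) \<in> sample_polynomials n"
    by (intro sample_polynomials.prod continuous_intros prod f)
  then show ?case by (simp add: prod.distrib)
next
  case (linear g h c)
  from sample_polynomials.linear[OF linear(3,4), of c]
  show ?case by (simp add: algebra_simps)
qed

lemma sample_polynomials_integral:
  assumes "g \<in> sample_polynomials n"
  shows "continuous_map weak_topology euclideanreal (\<lambda>P. \<integral>x. g x \<partial>(\<Pi>\<^sub>M k\<in>{..<n}. P))"
    and "P \<in> borel_prob_measures \<Longrightarrow> integrable (\<Pi>\<^sub>M k\<in>{..<n}. P) g"
proof -
  have "continuous_map weak_topology euclideanreal (\<lambda>P. \<integral>x. g x \<partial>(\<Pi>\<^sub>M k\<in>{..<n}. P))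
      \<and> (\<forall>P\<in>borel_prob_measures. integrable (\<Pi>\<^sub>M k\<in>{..<n}. P) g)"
    using assms
  proof induction
    case (prod f)
    have int: "integrable P (f k)" if P: "P \<in> borel_prob_measures" for P k
    proof -
      obtain b where "\<And>y. \<bar>f k y\<bar> \<le> b"
        using prod(2)[of k] by (auto simp: bounded_iff)
      then show ?thesis by (rule integrable_continuous_bounded[OF P prod(1)])
    qed
    have "continuous_map weak_topology euclideanreal (\<lambda>P. \<Prod>k<n. \<integral>y. f k y \<partial>P)"
      using prod by (intro continuous_map_prod continuous_map_weak_integral) auto
    then have 1: "continuous_map weak_topology euclideanreal
        (\<lambda>P. \<integral>x. (\<Prod>k<n. f k (x k)) \<partial>(\<Pi>\<^sub>M k\<in>{..<n}. P))"
      by (rule continuous_map_eq) (simp add: integral_sample_prod int)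
    have 2: "integrable (\<Pi>\<^sub>M k\<in>{..<n}. P) (\<lambda>x. \<Prod>k<n. f k (x k))"
      if P: "P \<in> borel_prob_measures" for P
    proof -
      have int_P: "integrable P (f k)" for k by (rule int[OF P])
      interpret product_prob_space "\<lambda>_::nat. P"
        by (intro product_prob_spaceI borel_prob_measuresD(1)[OF P])
      show ?thesis using int_P by (intro product_integrable_prod) auto
    qed
    from 1 2 show ?case by blast
  next
    case (linear g h c)
    have "continuous_map weak_topology euclideanreal
        (\<lambda>P. (\<integral>x. g x \<partial>(\<Pi>\<^sub>M k\<in>{..<n}. P)) + c * (\<integral>x. h x \<partial>(\<Pi>\<^sub>M k\<in>{..<n}. P)))"
      using linear by (intro continuous_map_add continuous_map_real_mult_left) auto
    then have "continuous_map weak_topology euclideanreal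
        (\<lambda>P. \<integral>x. g x + c * h x \<partial>(\<Pi>\<^sub>M k\<in>{..<n}. P))"
      by (rule continuous_map_eq) (use linear in simp)
    then show ?case using linear by simp
  qed
  then show "continuous_map weak_topology euclideanreal (\<lambda>P. \<integral>x. g x \<partial>(\<Pi>\<^sub>M k\<in>{..<n}. P))"
    "P \<in> borel_prob_measures \<Longrightarrow> integrable (\<Pi>\<^sub>M k\<in>{..<n}. P) g"
    by blast+
qed

lemma sample_polynomials_prod_one_minus:
  fixes f :: "nat \<Rightarrow> nat \<Rightarrow> 'a::topological_space \<Rightarrow> real"
  assumes "\<And>j k. continuous_on UNIV (f j k)" "\<And>j k. bounded (range (f j k))"
  shows "(\<lambda>x. 1 - (\<Prod>j<m. (1 - (\<Prod>k<n. f j k (x k))) ^ N)) \<in> sample_polynomials n"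
proof -
  have one: "(\<lambda>x. 1) \<in> sample_polynomials n"
    using sample_polynomials.prod[of "\<lambda>_ _. 1" n] by simp
  have step: "(\<lambda>x. g x * (1 - (\<Prod>k<n. f j k (x k)))) \<in> sample_polynomials n"
    if "g \<in> sample_polynomials n" for g j
    using sample_polynomials.linear[OF that sample_polynomials_mult_prod[OF that assms], of "-1"]
    by (simp add: algebra_simps)
  have step_power: "(\<lambda>x. g x * (1 - (\<Prod>k<n. f j k (x k))) ^ N) \<in> sample_polynomials n"
    if "g \<in> sample_polynomials n" for g j N
  proof (induction N)
    case (Suc N)
    from step[OF this, of j] show ?case by (simp add: mult_ac)
  qed (use that in simp)
  have "(\<lambda>x. \<Prod>j<m. (1 - (\<Prod>k<n. f j k (x k))) ^ N) \<in> sample_polynomials n"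
  proof (induction m)
    case (Suc m)
    from step_power[OF this, of m] show ?case by simp
  qed (use one in simp)
  from sample_polynomials.linear[OF one this, of "-1"] show ?thesis by simp
qed

text \<open>
  An open subset of the product is a union of positivity sets of products of bumps, and countably many
  products \<open>h j\<close> suffice. The functions \<open>1 - (\<Prod>j<m. (1 - h j x) ^ m)\<close> vanish off \<open>G\<close>, stay
  below \<open>1\<close>, and tend to \<open>1\<close> wherever some \<open>h j\<close> is positive. Unlike finite maxima
  of the \<open>h j\<close>, they are sample polynomials.
\<close>
lemma indicator_open_limit_of_sample_polynomials:
  fixes G :: "(nat \<Rightarrow> 'a::{metric_space, second_countable_topology}) set"
  assumes G: "openin (product_topology (\<lambda>_. euclidean) {..<n}) G"
  obtains g where "\<And>m. g m \<in> sample_polynomials n"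
    "\<And>m x. x \<in> {..<n} \<rightarrow>\<^sub>E UNIV \<Longrightarrow> 0 \<le> g m x \<and> g m x \<le> indicator G x"
    "\<And>x. x \<in> {..<n} \<rightarrow>\<^sub>E UNIV \<Longrightarrow> (\<lambda>m. g m x) \<longlonglongrightarrow> indicator G x"
proof (cases "G = {}")
  case True
  have "(\<lambda>x. 0) \<in> sample_polynomials n"
    using sample_polynomials_prod_one_minus[of "\<lambda>_ _ _. 0" n 0 0] by simp
  with True show thesis by (intro that[of "\<lambda>_ _. 0"]) auto
next
  case False
  obtain F :: "('a \<Rightarrow> real) set" where F: "countable F"
    "\<And>\<phi>. \<phi> \<in> F \<Longrightarrow> continuous_on UNIV \<phi>"
    "\<And>\<phi> x. \<phi> \<in> F \<Longrightarrow> 0 \<le> \<phi> x \<and> \<phi> x \<le> 1"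
    "\<And>U y r t. open U \<Longrightarrow> y \<in> U \<Longrightarrow> 0 \<le> r \<Longrightarrow> r < t \<Longrightarrow> t \<le> 1 \<Longrightarrow>
       \<exists>\<phi>\<in>F. r < \<phi> y \<and> (\<forall>z. \<phi> z \<le> t) \<and> (\<forall>z. z \<notin> U \<longrightarrow> \<phi> z = 0)"
    using countable_bump_family by blast
  define H where "H = {f \<in> {..<n} \<rightarrow>\<^sub>E F. \<forall>x\<in>{..<n} \<rightarrow>\<^sub>E UNIV. 0 < (\<Prod>k<n. f k (x k)) \<longrightarrow> x \<in> G}"
  have ex_H: "\<exists>f\<in>H. 0 < (\<Prod>k<n. f k (x k))" if "x \<in> G" for x
  proof -
    have "\<exists>U. (\<forall>k\<in>{..<n}. openin euclidean (U k)) \<and> x \<in> Pi\<^sub>E {..<n} U \<and> Pi\<^sub>E {..<n} U \<subseteq> G"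
      using G \<open>x \<in> G\<close> unfolding openin_product_topology_alt by blast
    then obtain U where U: "\<And>k. k < n \<Longrightarrow> open (U k)" "x \<in> Pi\<^sub>E {..<n} U" "Pi\<^sub>E {..<n} U \<subseteq> G"
      by (metis lessThan_iff open_openin)
    have "\<exists>\<phi>\<in>F. 0 < \<phi> (x k) \<and> (\<forall>z. z \<notin> U k \<longrightarrow> \<phi> z = 0)" if "k < n" for k
      using F(4)[OF U(1)[OF that], of "x k" 0 1] U(2) that by fastforce
    then obtain \<phi> where \<phi>: "\<And>k. k < n \<Longrightarrow> \<phi> k \<in> F" "\<And>k. k < n \<Longrightarrow> 0 < \<phi> k (x k)"
      "\<And>k z. k < n \<Longrightarrow> z \<notin> U k \<Longrightarrow> \<phi> k z = 0"
      by metis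
    have "z \<in> G" if z: "z \<in> {..<n} \<rightarrow>\<^sub>E UNIV" "0 < (\<Prod>k<n. \<phi> k (z k))" for z
    proof -
      have "\<phi> k (z k) \<noteq> 0" if "k < n" for k
        using z(2) that by (auto simp: less_le prod_zero_iff)
      then have "z k \<in> U k" if "k < n" for k
        using \<phi>(3) that by blast
      then show ?thesis using U(3) z(1) by auto
    qed
    then have "restrict \<phi> {..<n} \<in> H"
      using \<phi>(1) by (auto simp: H_def)
    moreover have "0 < (\<Prod>k<n. restrict \<phi> {..<n} k (x k))"
      using \<phi>(2) by (auto intro!: prod_pos)
    ultimately show ?thesis by blast
  qed
  have "countable H"
    unfolding H_def by (rule countable_subset[of _ "{..<n} \<rightarrow>\<^sub>E F"]) (auto intro!: countable_PiE F)
  moreover have "H \<noteq> {}" using ex_H False by blast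
  ultimately have range_H: "range (from_nat_into H) = H" by simp
  \<comment> \<open>Beyond index \<open>n\<close> the members of \<open>H\<close> are undefined; the constant \<open>1\<close> makes every \<open>f j k\<close>
      continuous and bounded without changing the products.\<close>
  define f where "f j k = (if k < n then from_nat_into H j k else (\<lambda>_. 1))" for j k
  have f_F: "f j k \<in> F \<or> f j k = (\<lambda>_. 1)" for j k
  proof -
    have "from_nat_into H j \<in> H" using range_H by blast
    then show ?thesis by (auto simp: f_def H_def)
  qed
  have f_cont: "continuous_on UNIV (f j k)" for j k
    using f_F[of j k] F(2) by auto
  have f_01: "0 \<le> f j k y \<and> f j k y \<le> 1" for j k y
    using f_F[of j k] F(3) by auto
  have f_bdd: "bounded (range (f j k))" for j k
    using f_01 by (intro boundedI[of _ 1]) auto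
  define h where "h j x = (\<Prod>k<n. f j k (x k))" for j x
  have h_01: "0 \<le> h j x" "h j x \<le> 1" for j x
    unfolding h_def using f_01 by (auto intro!: prod_nonneg prod_le_1)
  have h_eq: "h j x = (\<Prod>k<n. from_nat_into H j k (x k))" for j x
    by (simp add: h_def f_def)
  have h_0: "h j x = 0" if "x \<in> {..<n} \<rightarrow>\<^sub>E UNIV" "x \<notin> G" for j x
  proof -
    have "from_nat_into H j \<in> H" using range_H by blast
    then have "\<not> 0 < h j x" using that by (auto simp: h_eq H_def)
    then show ?thesis using h_01(1)[of j x] by simp
  qed
  define g where "g m x = 1 - (\<Prod>j<m. (1 - h j x) ^ m)" for m x
  have g_01: "0 \<le> g m x" "g m x \<le> 1" for m x
    unfolding g_def using h_01 by (auto intro!: prod_nonneg prod_le_1 power_le_one)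
  show thesis
  proof (rule that)
    show "g m \<in> sample_polynomials n" for m
      unfolding g_def[abs_def] h_def by (rule sample_polynomials_prod_one_minus[OF f_cont f_bdd])
    show "0 \<le> g m x \<and> g m x \<le> indicator G x" if x: "x \<in> {..<n} \<rightarrow>\<^sub>E UNIV" for m x
    proof (cases "x \<in> G")
      case True
      then show ?thesis using g_01 by simp
    next
      case False
      then show ?thesis using h_0[OF x] by (simp add: g_def)
    qed
    show "(\<lambda>m. g m x) \<longlonglongrightarrow> indicator G x" if x: "x \<in> {..<n} \<rightarrow>\<^sub>E UNIV" for x
    proof (cases "x \<in> G")
      case True
      then obtain f0 where "f0 \<in> H" "0 < (\<Prod>k<n. f0 k (x k))" using ex_H by blast
      then obtain i where i: "0 < h i x" using range_H unfolding h_eq by (metis imageE)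
      have "1 - (1 - h i x) ^ m \<le> g m x" if "m \<ge> Suc i" for m
      proof -
        have "(\<Prod>j<m. (1 - h j x) ^ m) = (1 - h i x) ^ m * (\<Prod>j\<in>{..<m} - {i}. (1 - h j x) ^ m)"
          using that by (intro prod.remove) auto
        also have "\<dots> \<le> (1 - h i x) ^ m * 1"
          using h_01 by (intro mult_left_mono prod_le_1) (auto intro!: power_le_one)
        finally show ?thesis by (simp add: g_def)
      qed
      then have "\<forall>\<^sub>F m in sequentially. 1 - (1 - h i x) ^ m \<le> g m x"
        unfolding eventually_sequentially by blast
      moreover have "\<forall>\<^sub>F m in sequentially. g m x \<le> 1"
        using g_01 by simp
      moreover have "(\<lambda>m. 1 - (1 - h i x) ^ m) \<longlonglongrightarrow> 1"
        using i h_01(2)[of i x] tendsto_diff[OF tendsto_const[of 1] LIMSEQ_power_zero[of "1 - h i x"]]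
        by simp
      ultimately have "(\<lambda>m. g m x) \<longlonglongrightarrow> 1"
        by (rule tendsto_sandwich[OF _ _ _ tendsto_const])
      with True show ?thesis by simp
    next
      case False
      then show ?thesis using h_0[OF x] by (simp add: g_def)
    qed
  qed
qed

text \<open>
  The measure of \<open>G\<close> is the supremum over \<open>m\<close> of the integrals of \<open>g m\<close>, by dominated
  convergence, and each of these integrals is weakly continuous.
\<close>
lemma openin_weak_topology_sample_measure_greater:
  fixes G :: "(nat \<Rightarrow> 'a::{metric_space, second_countable_topology}) set"
  assumes G: "openin (product_topology (\<lambda>_. euclidean) {..<n}) G"
  shows "openin weak_topology {P \<in> borel_prob_measures. r < measure (\<Pi>\<^sub>M k\<in>{..<n}. P) G}"
proof -
  obtain g where g: "\<And>m. g m \<in> sample_polynomials n"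
    "\<And>m x. x \<in> {..<n} \<rightarrow>\<^sub>E UNIV \<Longrightarrow> 0 \<le> g m x \<and> g m x \<le> indicator G x"
    "\<And>x. x \<in> {..<n} \<rightarrow>\<^sub>E UNIV \<Longrightarrow> (\<lambda>m. g m x) \<longlonglongrightarrow> indicator G x"
    using indicator_open_limit_of_sample_polynomials[OF G] by blast
  have "r < measure (\<Pi>\<^sub>M k\<in>{..<n}. P) G \<longleftrightarrow> (\<exists>m. r < (\<integral>x. g m x \<partial>(\<Pi>\<^sub>M k\<in>{..<n}. P)))"
    if P: "P \<in> borel_prob_measures" for P
  proof -
    let ?M = "\<Pi>\<^sub>M k\<in>{..<n}. P"
    interpret M: prob_space ?M using prob_space_sample[OF P] .
    have space: "space ?M = {..<n} \<rightarrow>\<^sub>E UNIV"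
      by (simp add: space_PiM borel_prob_measuresD(3)[OF P])
    have G_space: "G \<subseteq> space ?M"
      using openin_subset[OF G] by (simp add: space topspace_product_topology)
    have int_g: "integrable ?M (g m)" for m
      by (rule sample_polynomials_integral(2)[OF g(1) P])
    have "(indicator G :: _ \<Rightarrow> real) \<in> borel_measurable ?M"
      by (rule borel_measurable_LIMSEQ_real[where u = g])
        (simp_all only: space g(3) borel_measurable_integrable[OF int_g])
    then have "G \<in> M.events"
      using G_space by (simp add: borel_measurable_indicator_iff Int_absorb2)
    then have int_G: "integrable ?M (indicator G :: _ \<Rightarrow> real)"
      by (intro M.integrable_const_bound[of _ 1]) auto
    have measure: "(\<integral>x. indicator G x \<partial>?M) = M.prob G"
      using G_space by (simp add: Int_absorb2)
    have "norm (g m x) \<le> 1" if "x \<in> space ?M" for m x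
      using g(2)[of x m] that order_trans[OF _ indicator_le_1[of G x]] by (auto simp: space)
    then have "(\<lambda>m. \<integral>x. g m x \<partial>?M) \<longlonglongrightarrow> (\<integral>x. indicator G x \<partial>?M)"
      using int_g int_G g(3)
      by (intro integral_dominated_convergence[where w = "\<lambda>_. 1"] AE_I2) (auto simp: space)
    moreover have "(\<integral>x. g m x \<partial>?M) \<le> (\<integral>x. indicator G x \<partial>?M)" for m
      using int_g int_G g(2) by (intro integral_mono) (auto simp: space)
    ultimately show ?thesis
      unfolding measure
      using order_tendstoD(1)[of "\<lambda>m. \<integral>x. g m x \<partial>?M" "M.prob G" sequentially r]
      by (auto simp: eventually_sequentially intro: less_le_trans)
  qed
  then have "{P \<in> borel_prob_measures. r < measure (\<Pi>\<^sub>M k\<in>{..<n}. P) G}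
      = (\<Union>m. {P \<in> topspace weak_topology. r < (\<integral>x. g m x \<partial>(\<Pi>\<^sub>M k\<in>{..<n}. P))})"
    by auto
  moreover have "openin weak_topology {P \<in> topspace weak_topology. r < (\<integral>x. g m x \<partial>(\<Pi>\<^sub>M k\<in>{..<n}. P))}" for m
    using sample_polynomials_integral(1)[OF g(1)[of m]]
    by (simp only: continuous_map_upper_lower_semicontinuous_lt)
  ultimately show ?thesis by (metis (no_types, lifting) openin_Union imageE)
qed

section \<open>Nowhere dense and meager sets\<close>

lemma dense_in_iff:
  "dense_in T S \<longleftrightarrow> S \<subseteq> topspace T \<and> (\<forall>V. openin T V \<and> V \<noteq> {} \<longrightarrow> V \<inter> S \<noteq> {})"
  unfolding dense_in_def by (auto simp: dense_intersects_open Int_commute)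

lemma nowhere_dense_in_iff:
  "nowhere_dense_in T S \<longleftrightarrow> S \<subseteq> topspace T \<and>
     (\<forall>V. openin T V \<and> V \<noteq> {} \<longrightarrow> (\<exists>V'\<subseteq>V. openin T V' \<and> V' \<noteq> {} \<and> V' \<inter> S = {}))"
proof (cases "S \<subseteq> topspace T")
  case S: True
  have "T interior_of (T closure_of S) = {} \<longleftrightarrow>
     (\<forall>V. openin T V \<and> V \<noteq> {} \<longrightarrow> (\<exists>V'\<subseteq>V. openin T V' \<and> V' \<noteq> {} \<and> V' \<inter> S = {}))"
    (is "?L \<longleftrightarrow> ?R")
  proof
    assume L: ?L
    show ?R
    proof (intro allI impI)
      fix V assume V: "openin T V \<and> V \<noteq> {}"
      with L have "\<not> V \<subseteq> T closure_of S"
        by (metis interior_of_maximal subset_empty)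
      moreover have "openin T (V - T closure_of S)"
        using V by (intro openin_diff) auto
      moreover have "(V - T closure_of S) \<inter> S = {}"
        using closure_of_subset[OF S] by blast
      ultimately show "\<exists>V'\<subseteq>V. openin T V' \<and> V' \<noteq> {} \<and> V' \<inter> S = {}"
        by (intro exI[of _ "V - T closure_of S"]) auto
    qed
  next
    assume R: ?R
    show ?L
    proof (rule ccontr)
      assume "\<not> ?L"
      with R obtain V' where V': "V' \<subseteq> T interior_of (T closure_of S)" "openin T V'" "V' \<noteq> {}"
        "V' \<inter> S = {}"
        using openin_interior_of by metis
      then have "V' \<inter> T closure_of S = {}"
        by (simp add: openin_Int_closure_of_eq_empty)
      with V' interior_of_subset[of T "T closure_of S"] show False by blast
    qed
  qed
  with S show ?thesis by (simp add: nowhere_dense_in_def)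
qed (simp add: nowhere_dense_in_def)

lemma nowhere_dense_in_Un:
  assumes "nowhere_dense_in T M" "nowhere_dense_in T N"
  shows "nowhere_dense_in T (M \<union> N)"
  unfolding nowhere_dense_in_iff
proof (intro conjI allI impI)
  show "M \<union> N \<subseteq> topspace T" using assms by (simp add: nowhere_dense_in_iff)
  fix V assume "openin T V \<and> V \<noteq> {}"
  then obtain V1 where V1: "V1 \<subseteq> V" "openin T V1" "V1 \<noteq> {}" "V1 \<inter> M = {}"
    using assms(1) unfolding nowhere_dense_in_iff by metis
  then obtain V2 where "V2 \<subseteq> V1" "openin T V2" "V2 \<noteq> {}" "V2 \<inter> N = {}"
    using assms(2) unfolding nowhere_dense_in_iff by metis
  with V1 show "\<exists>V'\<subseteq>V. openin T V' \<and> V' \<noteq> {} \<and> V' \<inter> (M \<union> N) = {}"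
    by (intro exI[of _ V2]) blast
qed

lemma nowhere_dense_in_subtopology_imp:
  assumes "nowhere_dense_in (subtopology T H) N"
  shows "nowhere_dense_in T N"
  unfolding nowhere_dense_in_iff
proof (intro conjI allI impI)
  have N: "N \<subseteq> topspace T \<inter> H"
    using assms by (simp add: nowhere_dense_in_iff)
  then show "N \<subseteq> topspace T" by simp
  fix V assume V: "openin T V \<and> V \<noteq> {}"
  show "\<exists>V'\<subseteq>V. openin T V' \<and> V' \<noteq> {} \<and> V' \<inter> N = {}"
  proof (cases "V \<inter> H = {}")
    case True
    with V N show ?thesis by (intro exI[of _ V]) blast
  next
    case False
    moreover have "openin (subtopology T H) (V \<inter> H)"
      using V by (auto simp: openin_subtopology)
    ultimately obtain V' where V': "V' \<subseteq> V \<inter> H" "openin (subtopology T H) V'" "V' \<noteq> {}" "V' \<inter> N = {}"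
      using assms unfolding nowhere_dense_in_iff by metis
    then obtain U where U: "openin T U" "V' = U \<inter> H"
      by (auto simp: openin_subtopology)
    have "(V \<inter> U) \<inter> N = {}"
      using N V' U by blast
    moreover have "V \<inter> U \<noteq> {}"
      using V' U by blast
    ultimately show ?thesis
      using U V by (intro exI[of _ "V \<inter> U"]) auto
  qed
qed

lemma dense_in_complement_of_nowhere_dense:
  assumes "nowhere_dense_in T N"
  shows "dense_in T (topspace T - N)"
  unfolding dense_in_iff
proof (intro conjI allI impI)
  fix V assume "openin T V \<and> V \<noteq> {}"
  then obtain V' where "V' \<subseteq> V" "openin T V'" "V' \<noteq> {}" "V' \<inter> N = {}"
    using assms unfolding nowhere_dense_in_iff by metis
  then show "V \<inter> (topspace T - N) \<noteq> {}"
    using openin_subset by fastforce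
qed blast

text \<open>
  Every open set that meets the closure of \<open>U\<close> meets \<open>U\<close> itself, which lies in \<open>H\<close> and
  misses \<open>N\<close>. The smaller open sets that witness nowhere density are therefore cut out by \<open>U\<close>.
\<close>
lemma frontier_nowhere_dense_in:
  assumes "openin T U" "U \<subseteq> H" "N \<subseteq> topspace T \<inter> H" "N \<subseteq> T closure_of U - U"
  shows "nowhere_dense_in (subtopology T H) N"
  unfolding nowhere_dense_in_iff
proof (intro conjI allI impI)
  show "N \<subseteq> topspace (subtopology T H)" using assms(3) by simp
  fix V assume V: "openin (subtopology T H) V \<and> V \<noteq> {}"
  then obtain V1 where V1: "openin T V1" "V = V1 \<inter> H"
    by (auto simp: openin_subtopology)
  show "\<exists>V'\<subseteq>V. openin (subtopology T H) V' \<and> V' \<noteq> {} \<and> V' \<inter> N = {}"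
  proof (cases "V1 \<inter> U = {}")
    case True
    then have "V1 \<inter> T closure_of U = {}"
      using V1(1) by (simp add: openin_Int_closure_of_eq_empty)
    then have "V \<inter> N = {}" using V1(2) assms(4) by blast
    then show ?thesis using V by (intro exI[of _ V]) simp
  next
    case False
    have "openin (subtopology T H) (V1 \<inter> U)"
      using assms(1,2) V1(1) by (auto simp: openin_subtopology intro!: exI[of _ "V1 \<inter> U"])
    then show ?thesis
      using False assms(2,4) V1 by (intro exI[of _ "V1 \<inter> U"]) auto
  qed
qed

lemma meager_inI:
  assumes "\<And>k::nat. nowhere_dense_in T (N k)"
  shows "meager_in T (\<Union>k. N k)"
  unfolding meager_in_def using assms by (intro exI[of _ "range N"]) auto

lemma meager_in_Un:
  assumes "meager_in T M" "meager_in T N"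
  shows "meager_in T (M \<union> N)"
proof -
  obtain \<M> \<N> where "countable \<M>" "\<forall>N\<in>\<M>. nowhere_dense_in T N" "M = \<Union>\<M>"
    "countable \<N>" "\<forall>N\<in>\<N>. nowhere_dense_in T N" "N = \<Union>\<N>"
    using assms unfolding meager_in_def by blast
  then show ?thesis
    unfolding meager_in_def by (intro exI[of _ "\<M> \<union> \<N>"]) auto
qed

lemma Baire_topology_open_not_meager:
  assumes "Baire_topology T" "openin T V" "V \<noteq> {}" "meager_in T M"
  shows "\<not> V \<subseteq> M"
proof -
  have "M \<subseteq> topspace T"
    using assms(4) by (auto simp: meager_in_def nowhere_dense_in_def)
  then have "topspace T - (topspace T - M) = M" by blast
  then have "comeager_in T (topspace T - M)"
    using assms(4) by (simp add: comeager_in_def)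
  then have "dense_in T (topspace T - M)"
    using assms(1) by (simp add: Baire_topology_def)
  then show ?thesis
    using assms(2,3) unfolding dense_in_iff by blast
qed

section \<open>Consistency on a comeager set forces the hypotheses apart\<close>

lemma intertwined_in_iff:
  assumes "openin (subtopology weak_topology (H0 \<union> H1)) U"
  shows "intertwined_in H0 H1 U \<longleftrightarrow>
    (\<forall>V. openin (subtopology weak_topology (H0 \<union> H1)) V \<and> V \<subseteq> U \<and> V \<noteq> {} \<longrightarrow>
       V \<inter> H0 \<noteq> {} \<and> V \<inter> H1 \<noteq> {})"
proof -
  let ?T = "subtopology weak_topology (H0 \<union> H1)"
  have U: "U \<subseteq> H0 \<union> H1" "U \<subseteq> borel_prob_measures"
    using openin_subset[OF assms] by auto
  have "subtopology weak_topology U = subtopology ?T U"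
    using U by (simp add: subtopology_subtopology Int_absorb1)
  then have openin: "openin (subtopology weak_topology U) V \<longleftrightarrow> openin ?T V \<and> V \<subseteq> U" for V
    using openin_open_subtopology[OF assms] by simp
  have "dense_in (subtopology weak_topology U) (H \<inter> U) \<longleftrightarrow>
      (\<forall>V. openin ?T V \<and> V \<subseteq> U \<and> V \<noteq> {} \<longrightarrow> V \<inter> H \<noteq> {})" for H
  proof -
    have "V \<inter> (H \<inter> U) = V \<inter> H" if "V \<subseteq> U" for V using that by blast
    moreover have "H \<inter> U \<subseteq> topspace (subtopology weak_topology U)" using U by auto
    ultimately show ?thesis unfolding dense_in_iff openin by metis
  qed
  then show ?thesis unfolding intertwined_in_def by blast
qed

text \<open>
  In an open set \<open>U\<close> where both hypotheses are dense, each verdict has probability above \<open>2/3\<close>,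
  at some sample size beyond \<open>N\<close>, on a set \<open>A v N\<close> that is open by lower semicontinuity and dense
  in \<open>U\<close> by dense consistency. By the Baire property some measure in \<open>U\<close> lies in the consistency
  set and in all \<open>A v N\<close>. At this measure one verdict eventually has probability above \<open>2/3\<close>, while
  the other one also does so infinitely often, which is impossible for disjoint events.
\<close>
lemma comeager_consistency_imp_nowhere_intertwined:
  fixes H0 H1 :: "'a::polish_space measure set"
  assumes H: "H0 \<subseteq> borel_prob_measures" "H1 \<subseteq> borel_prob_measures"
    and Baire: "Baire_topology (subtopology weak_topology (H0 \<union> H1))"
    and \<phi>: "finite_precision \<phi>" "dense_consistency_each \<phi> H0 H1" "comeager_consistency \<phi> H0 H1"
  shows "nowhere_intertwined H0 H1"
proof (rule ccontr)
  let ?T = "subtopology weak_topology (H0 \<union> H1)"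
  have topspace: "topspace ?T = H0 \<union> H1" using H by auto
  assume "\<not> nowhere_intertwined H0 H1"
  then obtain U where U: "openin ?T U" "U \<noteq> {}"
    and "intertwined_in H0 H1 U"
    by (auto simp: nowhere_intertwined_def)
  then have meets: "V \<inter> H0 \<noteq> {}" "V \<inter> H1 \<noteq> {}" if "openin ?T V" "V \<subseteq> U" "V \<noteq> {}" for V
    using that by (auto simp: intertwined_in_iff)
  define p where "p v n P = measure (\<Pi>\<^sub>M k\<in>{..<n}. P) (verdict_region \<phi> n v)" for v n and P :: "'a measure"
  define A where "A v N = {P \<in> H0 \<union> H1. \<exists>n>N. 2/3 < p v n P}" for v and N :: nat
  have open_A: "openin ?T (A v N)" if v: "v \<in> {Accept0, Accept1}" for v N
  proof -
    have "openin ?T {P \<in> H0 \<union> H1. 2/3 < p v n P}" if "n > N" for n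
    proof -
      have "openin weak_topology {P \<in> borel_prob_measures. 2/3 < p v n P}"
        unfolding p_def
        using \<phi>(1) v that by (intro openin_weak_topology_sample_measure_greater) (auto simp: finite_precision_def)
      then show ?thesis
        using H by (auto simp: openin_subtopology intro!: exI[of _ "{P \<in> borel_prob_measures. 2/3 < p v n P}"])
    qed
    moreover have "A v N = (\<Union>n\<in>{N<..}. {P \<in> H0 \<union> H1. 2/3 < p v n P})"
      by (auto simp: A_def)
    ultimately show ?thesis by (auto intro!: openin_Union)
  qed
  have consistent_A: "\<exists>m. \<forall>n\<ge>m. 2/3 < p v n P" if "consistent_at \<phi> v P" for v P
  proof -
    have "(\<lambda>n. p v n P) \<longlonglongrightarrow> 1"
      using that by (simp add: consistent_at_def p_def)
    from order_tendstoD(1)[OF this, of "2/3"] show ?thesis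
      by (simp add: eventually_sequentially)
  qed
  have nowhere_dense: "nowhere_dense_in ?T (U - A v N)"
    if v: "v \<in> {Accept0, Accept1}" and K: "K \<subseteq> H0 \<union> H1"
      "densely_consistent_on \<phi> v K"
      "\<And>V. openin ?T V \<Longrightarrow> V \<subseteq> U \<Longrightarrow> V \<noteq> {} \<Longrightarrow> V \<inter> K \<noteq> {}" for v K N
    unfolding nowhere_dense_in_iff
  proof (intro conjI allI impI)
    show "U - A v N \<subseteq> topspace ?T" using openin_subset[OF U(1)] by blast
    fix V assume V: "openin ?T V \<and> V \<noteq> {}"
    show "\<exists>V'\<subseteq>V. openin ?T V' \<and> V' \<noteq> {} \<and> V' \<inter> (U - A v N) = {}"
    proof (cases "V \<inter> U = {}")
      case True
      with V show ?thesis by (intro exI[of _ V]) blast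
    next
      case False
      then have "V \<inter> U \<inter> K \<noteq> {}"
        using K(3)[of "V \<inter> U"] V U(1) by auto
      obtain D where D: "dense_in (subtopology weak_topology K) D" "\<And>P. P \<in> D \<Longrightarrow> consistent_at \<phi> v P"
        using K(2) by (auto simp: densely_consistent_on_def)
      have "openin ?T (V \<inter> U)" using V U(1) by blast
      then have "openin (subtopology ?T K) (V \<inter> U \<inter> K)"
        by (auto simp: openin_subtopology)
      then have "openin (subtopology weak_topology K) (V \<inter> U \<inter> K)"
        using K(1) by (simp add: subtopology_subtopology Int_absorb1)
      with D(1) \<open>V \<inter> U \<inter> K \<noteq> {}\<close> obtain P where P: "P \<in> V \<inter> U \<inter> K" "P \<in> D"
        unfolding dense_in_iff by blast
      obtain m where "\<forall>n\<ge>m. 2/3 < p v n P"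
        using consistent_A[OF D(2)[OF P(2)]] by blast
      then have "P \<in> A v N"
        using P(1) K(1) unfolding A_def by (auto intro!: exI[of _ "max m (Suc N)"])
      then have "V \<inter> U \<inter> A v N \<noteq> {}" using P by blast
      moreover have "openin ?T (V \<inter> U \<inter> A v N)"
        using V U(1) open_A[OF v] by blast
      ultimately show ?thesis
        by (intro exI[of _ "V \<inter> U \<inter> A v N"]) auto
    qed
  qed
  have "nowhere_dense_in ?T (U - A Accept0 N)" "nowhere_dense_in ?T (U - A Accept1 N)" for N
    using \<phi>(2) meets nowhere_dense[of Accept0 H0 N] nowhere_dense[of Accept1 H1 N]
    unfolding dense_consistency_each_def by blast+
  then have "meager_in ?T (\<Union>N. U - A Accept0 N)" "meager_in ?T (\<Union>N. U - A Accept1 N)"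
    by (intro meager_inI; blast)+
  moreover have "meager_in ?T (topspace ?T - consistency_set \<phi> H0 H1)"
    using \<phi>(3) by (simp add: comeager_consistency_def comeager_in_def)
  ultimately have "meager_in ?T ((topspace ?T - consistency_set \<phi> H0 H1)
      \<union> ((\<Union>N. U - A Accept0 N) \<union> (\<Union>N. U - A Accept1 N)))"
    by (intro meager_in_Un)
  from Baire_topology_open_not_meager[OF Baire U this]
  obtain P where "P \<in> U" "P \<notin> topspace ?T - consistency_set \<phi> H0 H1"
    "P \<notin> (\<Union>N. U - A Accept0 N)" "P \<notin> (\<Union>N. U - A Accept1 N)"
    by (meson UnCI subsetI)
  moreover have "P \<in> topspace ?T"
    using \<open>P \<in> U\<close> openin_subset[OF U(1)] by (rule subsetD[rotated])
  ultimately have P: "P \<in> consistency_set \<phi> H0 H1" "\<And>N. P \<in> A Accept0 N" "\<And>N. P \<in> A Accept1 N"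
    by auto
  from P(1) have "consistent_at \<phi> Accept0 P \<or> consistent_at \<phi> Accept1 P"
    unfolding consistency_set_def by blast
  with P(2,3) obtain v w where v: "consistent_at \<phi> v P" and w: "\<And>N. P \<in> A w N" "v \<noteq> w"
    by (metis verdict.distinct(1))
  obtain m where m: "\<And>n. n \<ge> m \<Longrightarrow> 2/3 < p v n P"
    using consistent_A[OF v] by blast
  obtain n where n: "n > m" "2/3 < p w n P"
    using w(1)[of m] by (auto simp: A_def)
  have P_prob: "P \<in> borel_prob_measures"
    using w(1)[of 0] H by (auto simp: A_def)
  let ?M = "\<Pi>\<^sub>M k\<in>{..<n}. P"
  interpret M: prob_space ?M using prob_space_sample[OF P_prob] .
  have gt: "2/3 < M.prob (verdict_region \<phi> n v)" "2/3 < M.prob (verdict_region \<phi> n w)"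
    using m[of n] n by (simp_all add: p_def)
  \<comment> \<open>Sets outside the \<open>\<sigma>\<close>-algebra get measure 0, so both regions are events.\<close>
  then have events: "verdict_region \<phi> n v \<in> M.events" "verdict_region \<phi> n w \<in> M.events"
    using measure_notin_sets[of "verdict_region \<phi> n v" ?M] measure_notin_sets[of "verdict_region \<phi> n w" ?M]
    by linarith+
  have "verdict_region \<phi> n v \<inter> verdict_region \<phi> n w = {}"
    using w(2) by (auto simp: verdict_region_def)
  with gt M.finite_measure_Union[OF events] M.prob_le_1[of "verdict_region \<phi> n v \<union> verdict_region \<phi> n w"]
  show False by simp
qed

section \<open>A test for nowhere intertwined hypotheses\<close>

lemma nowhere_intertwined_imp_interiors_dense:
  assumes H: "H0 \<subseteq> borel_prob_measures" "H1 \<subseteq> borel_prob_measures"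
    and "nowhere_intertwined H0 H1"
  defines "T \<equiv> subtopology weak_topology (H0 \<union> H1)"
  assumes V: "openin T V" "V \<noteq> {}"
  shows "V \<inter> (T interior_of H0 \<union> T interior_of H1) \<noteq> {}"
proof -
  have V_sub: "V \<subseteq> H0 \<union> H1" using openin_subset[OF V(1)] by (simp add: T_def)
  have "\<not> intertwined_in H0 H1 V"
    using assms by (auto simp: nowhere_intertwined_def)
  then obtain V' where V': "openin T V'" "V' \<subseteq> V" "V' \<noteq> {}" "V' \<inter> H0 = {} \<or> V' \<inter> H1 = {}"
    using intertwined_in_iff[OF V(1)[unfolded T_def]] unfolding T_def by blast
  then have "V' \<subseteq> H0 \<or> V' \<subseteq> H1"
    using V_sub by blast
  then have "V' \<subseteq> T interior_of H0 \<or> V' \<subseteq> T interior_of H1"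
    using V'(1) interior_of_maximal by metis
  with V' show ?thesis by blast
qed

lemma fsigma_sequence_of_open_Un_diff:
  fixes G C G' :: "'a::metric_space set"
  assumes "open G" "open C" "open G'"
  obtains A :: "nat \<Rightarrow> 'a set" where "\<And>k. closed (A k)" "(\<Union>k. A k) = G \<union> (C - G')"
proof -
  have "fsigma_in euclidean (G \<union> (C \<inter> - G'))"
    using assms by (intro fsigma_in_Un fsigma_in_Int open_imp_fsigma_in closed_imp_fsigma_in)
      (auto simp: metrizable_space_euclidean)
  then show thesis
    using that unfolding fsigma_in_ascending Diff_eq by (metis closed_closedin)
qed

text \<open>
  Accepting \<open>H0\<close> on its interior \<open>U0\<close> and \<open>H1\<close> on its interior \<open>U1\<close> is not enough: a
  hypothesis may have empty interior, like a single point against a punctured neighbourhood of it.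
  Away from the closure of \<open>U0\<close>, that is on \<open>V0\<close>, the interior \<open>U1\<close> is dense, so what remains of
  \<open>V0\<close> outside \<open>U1\<close> is negligible for \<open>H1\<close> and can be given to \<open>H0\<close> altogether, even where it
  contains elements of \<open>H1\<close>. This yields the disjoint acceptance sets
  \<open>U0 \<union> (V0 - U1)\<close> and \<open>U1 \<union> (V1 - U0)\<close>, both countable unions of closed sets. An element of \<open>H0\<close>
  outside the first one lies on the frontier of \<open>U0\<close>, which is nowhere dense in \<open>H0\<close>; likewise
  for \<open>H1\<close>.
\<close>
lemma nowhere_intertwined_imp_ae_consistency_each:
  fixes H0 H1 :: "'a::polish_space measure set"
  assumes H: "H0 \<subseteq> borel_prob_measures" "H1 \<subseteq> borel_prob_measures" and disj: "H0 \<inter> H1 = {}"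
    and "nowhere_intertwined H0 H1"
  shows "\<exists>\<phi>. is_test \<phi> \<and> finite_precision \<phi> \<and> ae_consistency_each \<phi> H0 H1"
proof -
  define T where "T = subtopology weak_topology (H0 \<union> H1)"
  have topspace: "topspace T = H0 \<union> H1" using H by (auto simp: T_def)
  define U0 where "U0 = T interior_of H0"
  define U1 where "U1 = T interior_of H1"
  define V0 where "V0 = topspace T - T closure_of U0"
  define V1 where "V1 = topspace T - T closure_of U1"
  have U: "openin T U0" "openin T U1" "U0 \<subseteq> H0" "U1 \<subseteq> H1"
    by (auto simp: U0_def U1_def interior_of_subset)
  have V: "openin T V0" "openin T V1"
    by (auto simp: V0_def V1_def intro!: openin_diff)
  have V_disj: "V0 \<inter> V1 = {}"
  proof (rule ccontr)
    assume "V0 \<inter> V1 \<noteq> {}"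
    then have "V0 \<inter> V1 \<inter> (U0 \<union> U1) \<noteq> {}"
      using nowhere_intertwined_imp_interiors_dense[OF H assms(4), of "V0 \<inter> V1"] V
      by (auto simp: T_def U0_def U1_def)
    moreover have "U0 \<subseteq> T closure_of U0" "U1 \<subseteq> T closure_of U1"
      using U(1,2) by (simp_all add: closure_of_subset openin_subset)
    ultimately show False by (auto simp: V0_def V1_def)
  qed
  obtain e :: "nat \<Rightarrow> 'a \<Rightarrow> real" where e: "\<And>i. continuous_on UNIV (e i)"
    "\<And>i x. 0 \<le> e i x \<and> e i x \<le> 1"
    "weak_topology = pullback_topology borel_prob_measures (moments e) euclidean"
    using weak_topology_eq_pullback_moments by blast
  have pullback: "\<exists>G. open G \<and> S = (H0 \<union> H1) \<inter> moments e -` G" if "openin T S" for S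
  proof -
    obtain S' where "openin weak_topology S'" "S = S' \<inter> (H0 \<union> H1)"
      using \<open>openin T S\<close> by (auto simp: T_def openin_subtopology)
    then obtain G where "open G" "S = (moments e -` G \<inter> borel_prob_measures) \<inter> (H0 \<union> H1)"
      by (auto simp: e(3) openin_pullback_topology)
    with H show ?thesis by (intro exI[of _ G]) auto
  qed
  obtain G0 G1 C0 C1 where G: "open G0" "open G1" "open C0" "open C1"
    "U0 = (H0 \<union> H1) \<inter> moments e -` G0" "U1 = (H0 \<union> H1) \<inter> moments e -` G1"
    "V0 = (H0 \<union> H1) \<inter> moments e -` C0" "V1 = (H0 \<union> H1) \<inter> moments e -` C1"
    using pullback[OF U(1)] pullback[OF U(2)] pullback[OF V(1)] pullback[OF V(2)] by blast
  obtain A :: "nat \<Rightarrow> (nat \<Rightarrow> real) set" where A: "\<And>k. closed (A k)" "(\<Union>k. A k) = G0 \<union> (C0 - G1)"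
    using fsigma_sequence_of_open_Un_diff[OF G(1,3,2)] by blast
  obtain B :: "nat \<Rightarrow> (nat \<Rightarrow> real) set" where B: "\<And>k. closed (B k)" "(\<Union>k. B k) = G1 \<union> (C1 - G0)"
    using fsigma_sequence_of_open_Un_diff[OF G(2,4,1)] by blast
  have "U0 \<inter> U1 = {}" using U disj by blast
  then have AB_disj: "moments e ` (H0 \<union> H1) \<inter> (\<Union>k. A k) \<inter> (\<Union>k. B k) = {}"
    using V_disj unfolding A(2) B(2) G by blast
  have "H0 \<union> H1 \<subseteq> borel_prob_measures" using H by simp
  from finite_precision_test_of_closed_sequences[OF this e(1,2) A(1) B(1) AB_disj]
  obtain \<phi> where \<phi>: "is_test \<phi>" "finite_precision \<phi>"
    "\<And>P. P \<in> H0 \<union> H1 \<Longrightarrow> moments e P \<in> (\<Union>k. A k) \<Longrightarrow> consistent_at \<phi> Accept0 P"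
    "\<And>P. P \<in> H0 \<union> H1 \<Longrightarrow> moments e P \<in> (\<Union>k. B k) \<Longrightarrow> consistent_at \<phi> Accept1 P"
    by blast
  have cons0: "consistent_at \<phi> Accept0 P" if "P \<in> U0 \<union> (V0 - U1)" for P
    using that unfolding G by (intro \<phi>(3)) (unfold A(2), blast+)
  have cons1: "consistent_at \<phi> Accept1 P" if "P \<in> U1 \<union> (V1 - U0)" for P
    using that unfolding G by (intro \<phi>(4)) (unfold B(2), blast+)
  have sub: "subtopology weak_topology H0 = subtopology T H0" "subtopology weak_topology H1 = subtopology T H1"
    by (simp_all add: T_def subtopology_subtopology Int_absorb1)
  have "ae_consistent_on \<phi> Accept0 H0"
    unfolding ae_consistent_on_def sub
  proof (intro exI conjI)
    show "nowhere_dense_in (subtopology T H0) {P \<in> H0. \<not> consistent_at \<phi> Accept0 P}"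
    proof (rule frontier_nowhere_dense_in[OF U(1,3)])
      show "{P \<in> H0. \<not> consistent_at \<phi> Accept0 P} \<subseteq> T closure_of U0 - U0"
        using cons0 U(4) disj by (auto simp: V0_def topspace)
    qed (auto simp: topspace)
  qed auto
  moreover have "ae_consistent_on \<phi> Accept1 H1"
    unfolding ae_consistent_on_def sub
  proof (intro exI conjI)
    show "nowhere_dense_in (subtopology T H1) {P \<in> H1. \<not> consistent_at \<phi> Accept1 P}"
    proof (rule frontier_nowhere_dense_in[OF U(2,4)])
      show "{P \<in> H1. \<not> consistent_at \<phi> Accept1 P} \<subseteq> T closure_of U1 - U1"
        using cons1 U(3) disj by (auto simp: V1_def topspace)
    qed (auto simp: topspace)
  qed auto
  ultimately show ?thesis
    using \<phi>(1,2) unfolding ae_consistency_each_def by blast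
qed

lemma ae_consistency_each_imp_dense_consistency_each:
  assumes "H0 \<subseteq> borel_prob_measures" "H1 \<subseteq> borel_prob_measures"
    and "ae_consistency_each \<phi> H0 H1"
  shows "dense_consistency_each \<phi> H0 H1"
proof -
  have "densely_consistent_on \<phi> v H"
    if "H \<subseteq> borel_prob_measures" "ae_consistent_on \<phi> v H" for v H
  proof -
    obtain N where N: "nowhere_dense_in (subtopology weak_topology H) N"
      "{P \<in> H. consistent_at \<phi> v P} = H - N"
      using \<open>ae_consistent_on \<phi> v H\<close> unfolding ae_consistent_on_def by blast
    have "topspace (subtopology weak_topology H) = H" using that by auto
    then have "dense_in (subtopology weak_topology H) (H - N)"
      using dense_in_complement_of_nowhere_dense[OF N(1)] by simp
    then show ?thesis
      using N(2) unfolding densely_consistent_on_def by blast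
  qed
  with assms show ?thesis
    by (simp add: ae_consistency_each_def dense_consistency_each_def)
qed

lemma ae_consistency_each_imp_ae_consistency:
  assumes disj: "H0 \<inter> H1 = {}" and ae: "ae_consistency_each \<phi> H0 H1"
  shows "ae_consistency \<phi> H0 H1"
proof -
  let ?T = "subtopology weak_topology (H0 \<union> H1)"
  have sub: "subtopology weak_topology H0 = subtopology ?T H0"
    "subtopology weak_topology H1 = subtopology ?T H1"
    by (simp_all add: subtopology_subtopology Int_absorb1)
  obtain N0 N1 where N: "nowhere_dense_in (subtopology ?T H0) N0" "nowhere_dense_in (subtopology ?T H1) N1"
    "{P \<in> H0. consistent_at \<phi> Accept0 P} = H0 - N0" "{P \<in> H1. consistent_at \<phi> Accept1 P} = H1 - N1"
    using ae unfolding ae_consistency_each_def ae_consistent_on_def sub by blast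
  have "N0 \<subseteq> H0" "N1 \<subseteq> H1"
    using N(1,2) unfolding nowhere_dense_in_def topspace_subtopology by simp_all
  then have "consistency_set \<phi> H0 H1 = (H0 \<union> H1) - (N0 \<union> N1)"
    unfolding consistency_set_def N(3,4) using disj by blast
  moreover have "nowhere_dense_in ?T (N0 \<union> N1)"
    by (rule nowhere_dense_in_Un[OF N(1,2)[THEN nowhere_dense_in_subtopology_imp]])
  ultimately show ?thesis
    unfolding ae_consistency_def by blast
qed

lemma ae_consistency_imp_comeager_consistency:
  assumes "H0 \<subseteq> borel_prob_measures" "H1 \<subseteq> borel_prob_measures" "ae_consistency \<phi> H0 H1"
  shows "comeager_consistency \<phi> H0 H1"
proof -
  let ?T = "subtopology weak_topology (H0 \<union> H1)"
  have topspace: "topspace ?T = H0 \<union> H1" using assms by auto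
  obtain N where N: "nowhere_dense_in ?T N" "consistency_set \<phi> H0 H1 = (H0 \<union> H1) - N"
    using assms(3) unfolding ae_consistency_def by blast
  have "N \<subseteq> H0 \<union> H1"
    using N(1) unfolding nowhere_dense_in_def topspace by simp
  then have "topspace ?T - consistency_set \<phi> H0 H1 = (\<Union>k::nat. N)"
    unfolding topspace N(2) by auto
  moreover have "meager_in ?T (\<Union>k::nat. N)" by (rule meager_inI) (rule N(1))
  ultimately show ?thesis
    unfolding comeager_consistency_def comeager_in_def topspace using N(2) by auto
qed

theorem theorem2:
  fixes H0 H1 :: "'a::polish_space measure set"
  assumes "H0 \<subseteq> borel_prob_measures" and "H1 \<subseteq> borel_prob_measures"
    and "H0 \<inter> H1 = {}"
    and "Baire_topology (subtopology weak_topology (H0 \<union> H1))"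
  shows "(nowhere_intertwined H0 H1 \<longleftrightarrow>
            (\<exists>\<phi>. is_test \<phi> \<and> finite_precision \<phi> \<and> ae_consistency_each \<phi> H0 H1)) \<and>
         (nowhere_intertwined H0 H1 \<longleftrightarrow>
            (\<exists>\<phi>. is_test \<phi> \<and> finite_precision \<phi> \<and>
                 dense_consistency_each \<phi> H0 H1 \<and> ae_consistency \<phi> H0 H1)) \<and>
         (nowhere_intertwined H0 H1 \<longleftrightarrow>
            (\<exists>\<phi>. is_test \<phi> \<and> finite_precision \<phi> \<and>
                 dense_consistency_each \<phi> H0 H1 \<and> comeager_consistency \<phi> H0 H1))"
proof -
  have "nowhere_intertwined H0 H1 \<Longrightarrow>
      \<exists>\<phi>. is_test \<phi> \<and> finite_precision \<phi> \<and> ae_consistency_each \<phi> H0 H1"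
    using nowhere_intertwined_imp_ae_consistency_each[OF assms(1-3)] .
  moreover have "dense_consistency_each \<phi> H0 H1 \<and> ae_consistency \<phi> H0 H1"
    if "ae_consistency_each \<phi> H0 H1" for \<phi> :: "'a test"
    using that ae_consistency_each_imp_dense_consistency_each[OF assms(1,2)]
      ae_consistency_each_imp_ae_consistency[OF assms(3)] by blast
  moreover have "comeager_consistency \<phi> H0 H1" if "ae_consistency \<phi> H0 H1" for \<phi> :: "'a test"
    using ae_consistency_imp_comeager_consistency[OF assms(1,2) that] .
  moreover have "nowhere_intertwined H0 H1"
    if "finite_precision \<phi>" "dense_consistency_each \<phi> H0 H1" "comeager_consistency \<phi> H0 H1" for \<phi>
    using comeager_consistency_imp_nowhere_intertwined[OF assms(1,2,4) that] .
  ultimately show ?thesis by blast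
qed

end
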